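(* Let $\langle P,H\rangle$ be a partial program and $\phi$ a $CTL^*$ formula such that the synthesis problem $\langle P,H,\phi\rangle$ is realizable, i.e., there is a resolving function $\Psi$ for $\langle P,H\rangle$ with $P_\Psi\models\phi$. Then every set of clauses $\Delta(P,H,\phi)$ produced by ${\textsf{Trans}}$ is satisfiable.
   Context: Fix a first-order background theory $\mathcal{T}$ with domain $\mathcal{E}$; an assertion is a formula of $\mathcal{T}$. A program is $D=(v,init(v),next(v,v'),J)$ where $v$ is a finite tuple of variables, $init(v)$ an assertion (or predicate application) over $v$, $next(v,v')$ an assertion over $v$ and a primed copy $v'$, $J=\{J_1,\dots,J_k\}$ a finite list of assertions (fairness conditions). States are valuations of $v$; a path is an infinite sequence $s_0s_1\dots$ with $next(s_i,s_{i+1})$; it is fair if each $J_i$ holds infinitely often (every path is fair if $J=\emptyset$). $CTL^*$ formulas are in negation normal form, built from assertions with $\wedge,\vee$, temporal operators $X,G,U$ ($F\psi=\mathit{true}\,U\,\psi$) and path quantifiers $A,E$ (all paths) and $A_f,E_f$ (fair paths). $D\models\phi$ iff every state satisfying $init$ satisfies $\phi$. A basic state formula is $Q\psi$, $Q$ a path quantifier, $\psi$ without path quantifiers; $\phi_1(\phi_2)$ denotes a formula with occurrences of subformula $\phi_2$, $\phi_1(\gamma)$ the result of replacing them by $\gamma$. Clauses are implications $body\to head$ over uninterpreted predicates (free variables universally quantified; heads may contain $\exists$; negations/disjunctions of predicate applications allowed), plus constraints $dwf(r)$. An interpretation $\mathcal{I}$ maps each predicate of arity $n$ to a subset of $\mathcal{E}^n$;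 it satisfies a set if all implications hold for all values and each $\mathcal{I}(r)$ with $dwf(r)$ is disjunctively well-founded (contained in a finite union of well-founded relations). A set is satisfiable if some interpretation satisfies it. ${\textsf{Trans}}$ nondeterministically computes $Clauses(v,init,next,J,\phi)$ ($D$ = first four arguments) by rules: (1) for a basic state subformula $\phi_1$ and fresh $aux$ of arity $|v|$: $Clauses(D,\phi_2(\phi_1))=Clauses(v,aux(v),next,J,\phi_1)\cup Clauses(D,\phi_2(aux(v)))$. (2) For basic $Q\psi$, $Q\in\{A,E\}$: $Clauses(D,Q\psi)=Clauses(v,init,next,\emptyset,Q_f\psi)$. (3) For assertion $c$, fresh boolean $x_X$: $Clauses(D,A_f\psi(Xc))=Clauses(v\cup\{x_X\},init,next\wedge(x_X=c(v')),J,A_f\psi(x_X))$; with fresh $aux$ of arity $|v|+1$: $Clauses(D,E_f\psi(Xc))=\{init(v)\to\exists x_X\,aux(v,x_X)\}\cup Clauses(v\cup\{x_X\},aux(v,x_X),next\wedge(x_X=c(v')),J,E_f\psi(x_X))$. (4) As (3) for $Gc$ with fresh $x_G$, conjunct $x_G=(c(v)\wedge x_G')$, fairness set $J\cup\{x_G\vee\neg c(v)\}$. (5) As (3) for $c_1Uc_2$ with fresh $x_U$, conjunct $x_U=(c_2(v)\vee(c_1(v)\wedge x_U'))$, fairness set $J\cup\{\neg x_U\vee c_2(v)\}$. (6) For assertion $c$, fresh $p$ (arity $|v|$), $r,t$ (arity $2|v|$), copies $v_0,\dots,v_k$: if $J\ne\emptyset$, $Clauses(D,A_fc)=\{init\wedge\neg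 c(v)\to p(v),\ next(v,v')\wedge p(v)\to p(v'),\ p(v_0)\wedge\bigwedge_{i=1}^k(t(v_{i-1},v_i)\wedge J_i(v_i))\to r(v_0,v_k),\ dwf(r),\ next(v,v')\to t(v,v'),\ t(v,v')\wedge next(v',v'')\to t(v,v'')\}$; if $J=\emptyset$ the third clause is $p(v)\wedge t(v,v')\to r(v,v')$. (7) For assertion $c$, fresh $q_i$ (arity $|v|$), $r_i$ (arity $2|v|$): if $J\ne\emptyset$, $Clauses(D,E_fc)=\{init\to c(v)\wedge q_1(v)\}\cup\{q_i(v)\to\exists v'.\,next(v,v')\wedge((J_i(v)\wedge q_{(i\bmod k)+1}(v'))\vee(r_i(v,v')\wedge q_i(v'))),\ dwf(r_i),\ r_i(v,v')\wedge r_i(v',v'')\to r_i(v,v'')\mid i\le k\}$; if $J=\emptyset$, fresh $q$: $\{init\to c(v)\wedge q(v),\ q(v)\to\exists v'.\,next(v,v')\wedge q(v')\}$. (8) For assertion $c$: $Clauses(D,c)=\{init(v)\to c(v)\}$. Synthesis: the variables are $v=\{pc\}\cup v_r$, $pc$ ranging over program locations. A partial program $\langle P,H\rangle$ is a program $P=(v,init,next,J)$ with a finite set $H$ of holes: condition holes $\langle l,l_t,l_f\rangle$ and assignment holes $\langle l,l'\rangle$ (locations). A resolving function $\Psi$ maps each condition hole to a subset of $\mathcal{E}^{|v_r|}$ and each assignment hole to a subset of $\mathcal{E}^{|v_r|}\times\mathcal{E}^{|v_r|}$ such that $\forall v_r\exists v_r'\,\Psi(\langle l,l'\rangle)(v_r,v_r')$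 for each assignment hole. The synthesized program is $P_\Psi=(v,init,next_\Psi,J)$ with $next_\Psi(v,v')=next(v,v')\vee\bigvee_{\langle l,l_t,l_f\rangle\in H}(pc=l\wedge pc'=l_t\wedge\Psi(\langle l,l_t,l_f\rangle)(v_r)\wedge v_r'=v_r)\vee\bigvee_{\langle l,l_t,l_f\rangle\in H}(pc=l\wedge pc'=l_f\wedge\neg\Psi(\langle l,l_t,l_f\rangle)(v_r)\wedge v_r'=v_r)\vee\bigvee_{\langle l,l'\rangle\in H}(pc=l\wedge pc'=l'\wedge\Psi(\langle l,l'\rangle)(v_r,v_r'))$. Introduce fresh predicates $u^c_l(v_r)$ for each condition hole $\langle l,l_t,l_f\rangle$ and $u^a_l(v_r,v_r')$ for each assignment hole $\langle l,l'\rangle$; $P_U=(v,init,next_U,J)$ where $next_U$ is $next_\Psi$ with $\Psi(\langle l,l_t,l_f\rangle)$ replaced by $u^c_l$ and $\Psi(\langle l,l'\rangle)$ by $u^a_l$. Let $\Delta_a(P,H)=\{\top\to\exists v_r'\,u^a_l(v_r,v_r')\mid\langle l,l'\rangle\in H\}$ and $\Delta(P,H,\phi)=\Delta_a(P,H)\cup Clauses(P_U,\phi)$, where $Clauses(P_U,\phi)$ is any set produced by ${\textsf{Trans}}$. *)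

theory Defs
  imports Main "HOL-Library.FuncSet" "HOL-Library.Infinite_Set" "HOL-Library.Ramsey"
begin

text \<open>
  The background theory is a fixed structure with domain \<open>'e\<close>. Every variable ranges over a
  subset \<open>rng T x\<close> of the domain: the program counter over the locations, a boolean variable
  over \<open>{tt T, ff T}\<close>, an ordinary variable for instance over \<open>UNIV\<close>. States, paths, the
  quantifiers inside assertions and the universally quantified variables of clauses all respect
  these ranges.
\<close>

record ('f, 'r, 'x, 'e) background =
  fsem :: "'f \<Rightarrow> 'e list \<Rightarrow> 'e"
  rsem :: "'r \<Rightarrow> 'e list \<Rightarrow> bool"
  rng :: "'x \<Rightarrow> 'e set"
  tt :: 'e
  ff :: 'e

definition background_theory :: "('f, 'r, 'x, 'e) background \<Rightarrow> bool" where
  "background_theory T \<longleftrightarrow> tt T \<noteq> ff T \<and> (\<forall>x. rng T x \<noteq> {})"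

text \<open>
  The variable \<open>(x, n)\<close> is the \<open>n\<close>-th copy of \<open>x\<close>: \<open>(x, 0)\<close> is \<open>x\<close> itself, \<open>(x, 1)\<close> is
  \<open>x\<close> primed, \<open>(x, 2)\<close> is \<open>x\<close> doubly primed, and so on. The terms \<open>Val a\<close> name elements of
  the domain; they are needed for locations and truth values. A predicate symbol is a name
  together with its arity.
\<close>

datatype ('f, 'x, 'e) tm =
    Var "'x \<times> nat"
  | Val 'e
  | Fn 'f "('f, 'x, 'e) tm list"

type_synonym 'p pred = "'p \<times> nat"

datatype ('f, 'r, 'p, 'x, 'e) fm =
    Top
  | Eq "('f, 'x, 'e) tm" "('f, 'x, 'e) tm"
  | Rel 'r "('f, 'x, 'e) tm list"
  | Pred "'p pred" "('f, 'x, 'e) tm list"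
  | Neg "('f, 'r, 'p, 'x, 'e) fm"
  | Conj "('f, 'r, 'p, 'x, 'e) fm" "('f, 'r, 'p, 'x, 'e) fm"
  | Disj "('f, 'r, 'p, 'x, 'e) fm" "('f, 'r, 'p, 'x, 'e) fm"
  | FEx "'x \<times> nat" "('f, 'r, 'p, 'x, 'e) fm"
  | FAll "'x \<times> nat" "('f, 'r, 'p, 'x, 'e) fm"

definition Iff :: "('f, 'r, 'p, 'x, 'e) fm \<Rightarrow> ('f, 'r, 'p, 'x, 'e) fm \<Rightarrow> ('f, 'r, 'p, 'x, 'e) fm" where
  "Iff f g = Disj (Conj f g) (Conj (Neg f) (Neg g))"

definition conjs :: "('f, 'r, 'p, 'x, 'e) fm list \<Rightarrow> ('f, 'r, 'p, 'x, 'e) fm" where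
  "conjs fs = foldr Conj fs Top"

definition disjs :: "('f, 'r, 'p, 'x, 'e) fm list \<Rightarrow> ('f, 'r, 'p, 'x, 'e) fm" where
  "disjs fs = foldr Disj fs (Neg Top)"

definition exs :: "'x list \<Rightarrow> nat \<Rightarrow> ('f, 'r, 'p, 'x, 'e) fm \<Rightarrow> ('f, 'r, 'p, 'x, 'e) fm" where
  "exs xs n f = foldr (\<lambda>x. FEx (x, n)) xs f"

definition copy :: "nat \<Rightarrow> 'x list \<Rightarrow> ('f, 'x, 'e) tm list" where
  "copy n xs = map (\<lambda>x. Var (x, n)) xs"

primrec tvars :: "('f, 'x, 'e) tm \<Rightarrow> ('x \<times> nat) set" where
  "tvars (Var y) = {y}"
| "tvars (Val a) = {}"
| "tvars (Fn f ts) = \<Union> (set (map tvars ts))"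

primrec fvars :: "('f, 'r, 'p, 'x, 'e) fm \<Rightarrow> ('x \<times> nat) set" where
  "fvars Top = {}"
| "fvars (Eq s t) = tvars s \<union> tvars t"
| "fvars (Rel r ts) = \<Union> (tvars ` set ts)"
| "fvars (Pred p ts) = \<Union> (tvars ` set ts)"
| "fvars (Neg f) = fvars f"
| "fvars (Conj f g) = fvars f \<union> fvars g"
| "fvars (Disj f g) = fvars f \<union> fvars g"
| "fvars (FEx y f) = fvars f - {y}"
| "fvars (FAll y f) = fvars f - {y}"

primrec preds :: "('f, 'r, 'p, 'x, 'e) fm \<Rightarrow> 'p pred set" where
  "preds Top = {}"
| "preds (Eq s t) = {}"
| "preds (Rel r ts) = {}"
| "preds (Pred p ts) = {p}"
| "preds (Neg f) = preds f"
| "preds (Conj f g) = preds f \<union> preds g"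
| "preds (Disj f g) = preds f \<union> preds g"
| "preds (FEx y f) = preds f"
| "preds (FAll y f) = preds f"

text \<open>
  \<open>shift k\<close> adds \<open>k\<close> primes to every variable. It renames bound variables as well and is
  injective on variables, so it captures nothing.
\<close>

primrec tshift :: "nat \<Rightarrow> ('f, 'x, 'e) tm \<Rightarrow> ('f, 'x, 'e) tm" where
  "tshift k (Var y) = Var (fst y, snd y + k)"
| "tshift k (Val a) = Val a"
| "tshift k (Fn f ts) = Fn f (map (tshift k) ts)"

primrec shift :: "nat \<Rightarrow> ('f, 'r, 'p, 'x, 'e) fm \<Rightarrow> ('f, 'r, 'p, 'x, 'e) fm" where
  "shift k Top = Top"
| "shift k (Eq s t) = Eq (tshift k s) (tshift k t)"
| "shift k (Rel r ts) = Rel r (map (tshift k) ts)"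
| "shift k (Pred p ts) = Pred p (map (tshift k) ts)"
| "shift k (Neg f) = Neg (shift k f)"
| "shift k (Conj f g) = Conj (shift k f) (shift k g)"
| "shift k (Disj f g) = Disj (shift k f) (shift k g)"
| "shift k (FEx y f) = FEx (fst y, snd y + k) (shift k f)"
| "shift k (FAll y f) = FAll (fst y, snd y + k) (shift k f)"

primrec tval :: "('f, 'r, 'x, 'e) background \<Rightarrow> ('x \<times> nat \<Rightarrow> 'e) \<Rightarrow> ('f, 'x, 'e) tm \<Rightarrow> 'e" where
  "tval T \<sigma> (Var y) = \<sigma> y"
| "tval T \<sigma> (Val a) = a"
| "tval T \<sigma> (Fn f ts) = fsem T f (map (tval T \<sigma>) ts)"

primrec eval :: "('f, 'r, 'x, 'e) background \<Rightarrow> ('p pred \<Rightarrow> 'e list set) \<Rightarrow>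
    ('x \<times> nat \<Rightarrow> 'e) \<Rightarrow> ('f, 'r, 'p, 'x, 'e) fm \<Rightarrow> bool" where
  "eval T I \<sigma> Top = True"
| "eval T I \<sigma> (Eq s t) = (tval T \<sigma> s = tval T \<sigma> t)"
| "eval T I \<sigma> (Rel r ts) = rsem T r (map (tval T \<sigma>) ts)"
| "eval T I \<sigma> (Pred p ts) = (map (tval T \<sigma>) ts \<in> I p)"
| "eval T I \<sigma> (Neg f) = (\<not> eval T I \<sigma> f)"
| "eval T I \<sigma> (Conj f g) = (eval T I \<sigma> f \<and> eval T I \<sigma> g)"
| "eval T I \<sigma> (Disj f g) = (eval T I \<sigma> f \<or> eval T I \<sigma> g)"
| "eval T I \<sigma> (FEx y f) = (\<exists>a\<in>rng T (fst y). eval T I (\<sigma>(y := a)) f)"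
| "eval T I \<sigma> (FAll y f) = (\<forall>a\<in>rng T (fst y). eval T I (\<sigma>(y := a)) f)"


section \<open>Temporal formulas and transition systems\<close>

datatype quant = QA | QE | QAf | QEf

datatype 'a sfm =
    Asrt 'a
  | SAnd "'a sfm" "'a sfm"
  | SOr "'a sfm" "'a sfm"
  | Quant quant "'a pfm"
and 'a pfm =
    St "'a sfm"
  | PAnd "'a pfm" "'a pfm"
  | POr "'a pfm" "'a pfm"
  | PX "'a pfm"
  | PG "'a pfm"
  | PU "'a pfm" "'a pfm"

record 's ts =
  inits :: "'s set"
  step :: "'s \<Rightarrow> 's \<Rightarrow> bool"
  fairness :: "('s \<Rightarrow> bool) list"

definition paths :: "'s ts \<Rightarrow> 's \<Rightarrow> (nat \<Rightarrow> 's) set" where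
  "paths M s = {\<pi>. \<pi> 0 = s \<and> (\<forall>i. step M (\<pi> i) (\<pi> (Suc i)))}"

definition fair_paths :: "'s ts \<Rightarrow> 's \<Rightarrow> (nat \<Rightarrow> 's) set" where
  "fair_paths M s = {\<pi> \<in> paths M s. \<forall>j\<in>set (fairness M). \<exists>\<^sub>\<infinity>i. j (\<pi> i)}"

primrec ssat :: "('a \<Rightarrow> 's \<Rightarrow> bool) \<Rightarrow> 's ts \<Rightarrow> 'a sfm \<Rightarrow> 's \<Rightarrow> bool"
  and psat :: "('a \<Rightarrow> 's \<Rightarrow> bool) \<Rightarrow> 's ts \<Rightarrow> 'a pfm \<Rightarrow> (nat \<Rightarrow> 's) \<Rightarrow> bool" where
  "ssat val M (Asrt c) s = val c s"
| "ssat val M (SAnd a b) s = (ssat val M a s \<and> ssat val M b s)"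
| "ssat val M (SOr a b) s = (ssat val M a s \<or> ssat val M b s)"
| "ssat val M (Quant q p) s = (case q of
      QA \<Rightarrow> (\<forall>\<pi>\<in>paths M s. psat val M p \<pi>)
    | QE \<Rightarrow> (\<exists>\<pi>\<in>paths M s. psat val M p \<pi>)
    | QAf \<Rightarrow> (\<forall>\<pi>\<in>fair_paths M s. psat val M p \<pi>)
    | QEf \<Rightarrow> (\<exists>\<pi>\<in>fair_paths M s. psat val M p \<pi>))"
| "psat val M (St a) \<pi> = ssat val M a (\<pi> 0)"
| "psat val M (PAnd p q) \<pi> = (psat val M p \<pi> \<and> psat val M q \<pi>)"
| "psat val M (POr p q) \<pi> = (psat val M p \<pi> \<or> psat val M q \<pi>)"
| "psat val M (PX p) \<pi> = psat val M p (\<lambda>n. \<pi> (Suc n))"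
| "psat val M (PG p) \<pi> = (\<forall>i. psat val M p (\<lambda>n. \<pi> (i + n)))"
| "psat val M (PU p q) \<pi> = (\<exists>i. psat val M q (\<lambda>n. \<pi> (i + n)) \<and>
      (\<forall>j<i. psat val M p (\<lambda>n. \<pi> (j + n))))"

definition models :: "('a \<Rightarrow> 's \<Rightarrow> bool) \<Rightarrow> 's ts \<Rightarrow> 'a sfm \<Rightarrow> bool" where
  "models val M \<phi> \<longleftrightarrow> (\<forall>s\<in>inits M. ssat val M \<phi> s)"

primrec s_qfree :: "'a sfm \<Rightarrow> bool" and p_qfree :: "'a pfm \<Rightarrow> bool" where
  "s_qfree (Asrt c) = True"
| "s_qfree (SAnd a b) = (s_qfree a \<and> s_qfree b)"
| "s_qfree (SOr a b) = (s_qfree a \<and> s_qfree b)"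
| "s_qfree (Quant q p) = False"
| "p_qfree (St a) = s_qfree a"
| "p_qfree (PAnd p q) = (p_qfree p \<and> p_qfree q)"
| "p_qfree (POr p q) = (p_qfree p \<and> p_qfree q)"
| "p_qfree (PX p) = p_qfree p"
| "p_qfree (PG p) = p_qfree p"
| "p_qfree (PU p q) = (p_qfree p \<and> p_qfree q)"

text \<open>A Boolean combination of assertions is an assertion; these relations compute it.\<close>

inductive s_assn :: "('f, 'r, 'p, 'x, 'e) fm sfm \<Rightarrow> ('f, 'r, 'p, 'x, 'e) fm \<Rightarrow> bool" where
  "s_assn (Asrt c) c"
| "s_assn a c \<Longrightarrow> s_assn b d \<Longrightarrow> s_assn (SAnd a b) (Conj c d)"
| "s_assn a c \<Longrightarrow> s_assn b d \<Longrightarrow> s_assn (SOr a b) (Disj c d)"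

inductive p_assn :: "('f, 'r, 'p, 'x, 'e) fm pfm \<Rightarrow> ('f, 'r, 'p, 'x, 'e) fm \<Rightarrow> bool" where
  "s_assn a c \<Longrightarrow> p_assn (St a) c"
| "p_assn p c \<Longrightarrow> p_assn q d \<Longrightarrow> p_assn (PAnd p q) (Conj c d)"
| "p_assn p c \<Longrightarrow> p_assn q d \<Longrightarrow> p_assn (POr p q) (Disj c d)"

text \<open>State subformulas, and the replacement of all occurrences of a state subformula \<open>\<alpha>\<close>.\<close>

primrec s_subs :: "'a sfm \<Rightarrow> 'a sfm set" and p_subs :: "'a pfm \<Rightarrow> 'a sfm set" where
  "s_subs (Asrt c) = {Asrt c}"
| "s_subs (SAnd a b) = {SAnd a b} \<union> s_subs a \<union> s_subs b"
| "s_subs (SOr a b) = {SOr a b} \<union> s_subs a \<union> s_subs b"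
| "s_subs (Quant q p) = {Quant q p} \<union> p_subs p"
| "p_subs (St a) = s_subs a"
| "p_subs (PAnd p q) = p_subs p \<union> p_subs q"
| "p_subs (POr p q) = p_subs p \<union> p_subs q"
| "p_subs (PX p) = p_subs p"
| "p_subs (PG p) = p_subs p"
| "p_subs (PU p q) = p_subs p \<union> p_subs q"

primrec s_repl :: "'a sfm \<Rightarrow> 'a sfm \<Rightarrow> 'a sfm \<Rightarrow> 'a sfm"
  and p_repl :: "'a sfm \<Rightarrow> 'a sfm \<Rightarrow> 'a pfm \<Rightarrow> 'a pfm" where
  "s_repl \<alpha> \<gamma> (Asrt c) = (if Asrt c = \<alpha> then \<gamma> else Asrt c)"
| "s_repl \<alpha> \<gamma> (SAnd a b) = (if SAnd a b = \<alpha> then \<gamma> else SAnd (s_repl \<alpha> \<gamma> a) (s_repl \<alpha> \<gamma> b))"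
| "s_repl \<alpha> \<gamma> (SOr a b) = (if SOr a b = \<alpha> then \<gamma> else SOr (s_repl \<alpha> \<gamma> a) (s_repl \<alpha> \<gamma> b))"
| "s_repl \<alpha> \<gamma> (Quant q p) = (if Quant q p = \<alpha> then \<gamma> else Quant q (p_repl \<alpha> \<gamma> p))"
| "p_repl \<alpha> \<gamma> (St a) = St (s_repl \<alpha> \<gamma> a)"
| "p_repl \<alpha> \<gamma> (PAnd p q) = PAnd (p_repl \<alpha> \<gamma> p) (p_repl \<alpha> \<gamma> q)"
| "p_repl \<alpha> \<gamma> (POr p q) = POr (p_repl \<alpha> \<gamma> p) (p_repl \<alpha> \<gamma> q)"
| "p_repl \<alpha> \<gamma> (PX p) = PX (p_repl \<alpha> \<gamma> p)"
| "p_repl \<alpha> \<gamma> (PG p) = PG (p_repl \<alpha> \<gamma> p)"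
| "p_repl \<alpha> \<gamma> (PU p q) = PU (p_repl \<alpha> \<gamma> p) (p_repl \<alpha> \<gamma> q)"

text \<open>
  The same for a path subformula \<open>\<alpha>\<close>. These are only used on formulas without path
  quantifiers, where no path formula occurs below a state formula.
\<close>

primrec t_subs :: "'a pfm \<Rightarrow> 'a pfm set" where
  "t_subs (St a) = {St a}"
| "t_subs (PAnd p q) = {PAnd p q} \<union> t_subs p \<union> t_subs q"
| "t_subs (POr p q) = {POr p q} \<union> t_subs p \<union> t_subs q"
| "t_subs (PX p) = {PX p} \<union> t_subs p"
| "t_subs (PG p) = {PG p} \<union> t_subs p"
| "t_subs (PU p q) = {PU p q} \<union> t_subs p \<union> t_subs q"

primrec t_repl :: "'a pfm \<Rightarrow> 'a pfm \<Rightarrow> 'a pfm \<Rightarrow> 'a pfm" where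
  "t_repl \<alpha> \<gamma> (St a) = (if St a = \<alpha> then \<gamma> else St a)"
| "t_repl \<alpha> \<gamma> (PAnd p q) = (if PAnd p q = \<alpha> then \<gamma> else PAnd (t_repl \<alpha> \<gamma> p) (t_repl \<alpha> \<gamma> q))"
| "t_repl \<alpha> \<gamma> (POr p q) = (if POr p q = \<alpha> then \<gamma> else POr (t_repl \<alpha> \<gamma> p) (t_repl \<alpha> \<gamma> q))"
| "t_repl \<alpha> \<gamma> (PX p) = (if PX p = \<alpha> then \<gamma> else PX (t_repl \<alpha> \<gamma> p))"
| "t_repl \<alpha> \<gamma> (PG p) = (if PG p = \<alpha> then \<gamma> else PG (t_repl \<alpha> \<gamma> p))"
| "t_repl \<alpha> \<gamma> (PU p q) = (if PU p q = \<alpha> then \<gamma> else PU (t_repl \<alpha> \<gamma> p) (t_repl \<alpha> \<gamma> q))"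


section \<open>Clauses\<close>

datatype ('f, 'r, 'p, 'x, 'e) clause =
    Imp "('f, 'r, 'p, 'x, 'e) fm" "('f, 'r, 'p, 'x, 'e) fm"
  | Dwf "'p pred"

definition interpretation_of_preds :: "('p pred \<Rightarrow> 'e list set) \<Rightarrow> bool" where
  "interpretation_of_preds I \<longleftrightarrow> (\<forall>p n. I (p, n) \<subseteq> {as. length as = n})"

text \<open>
  A relation is well-founded in the sense of \<open>dwf\<close> if it has no infinite chain
  \<open>a\<^sub>0 R a\<^sub>1 R a\<^sub>2 \<dots>\<close>, that is, if its converse satisfies \<open>wf\<close>.
\<close>

definition rel_of :: "'e list set \<Rightarrow> ('e list \<times> 'e list) set" where
  "rel_of A = {(as, bs). length as = length bs \<and> as @ bs \<in> A}"

primrec sat_clause :: "('f, 'r, 'x, 'e) background \<Rightarrow> ('p pred \<Rightarrow> 'e list set) \<Rightarrow>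
    ('f, 'r, 'p, 'x, 'e) clause \<Rightarrow> bool" where
  "sat_clause T I (Imp body head) =
    (\<forall>\<sigma>. (\<forall>y. \<sigma> y \<in> rng T (fst y)) \<longrightarrow> eval T I \<sigma> body \<longrightarrow> eval T I \<sigma> head)"
| "sat_clause T I (Dwf r) = disj_wf ((rel_of (I r))\<inverse>)"

definition satisfiable :: "('f, 'r, 'x, 'e) background \<Rightarrow>
    ('f, 'r, 'p, 'x, 'e) clause set \<Rightarrow> bool" where
  "satisfiable T C \<longleftrightarrow> (\<exists>I. interpretation_of_preds I \<and> (\<forall>c\<in>C. sat_clause T I c))"


section \<open>Programs and clause generation\<close>

datatype ('f, 'r, 'p, 'x, 'e) program =
  Program (vars: "'x list") (init: "('f, 'r, 'p, 'x, 'e) fm")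
    (nxt: "('f, 'r, 'p, 'x, 'e) fm") (fair: "('f, 'r, 'p, 'x, 'e) fm list")

definition assertion_over :: "('x \<times> nat) set \<Rightarrow> ('f, 'r, 'p, 'x, 'e) fm \<Rightarrow> bool" where
  "assertion_over V c \<longleftrightarrow> preds c = {} \<and> fvars c \<subseteq> V"

definition program :: "('f, 'r, 'p, 'x, 'e) program \<Rightarrow> bool" where
  "program D \<longleftrightarrow> distinct (vars D) \<and>
    assertion_over (set (vars D) \<times> {0}) (init D) \<and>
    assertion_over (set (vars D) \<times> {0, 1}) (nxt D) \<and>
    (\<forall>j\<in>set (fair D). assertion_over (set (vars D) \<times> {0}) j)"

definition ctl_star_formula :: "'x list \<Rightarrow> ('f, 'r, 'p, 'x, 'e) fm sfm \<Rightarrow> bool" where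
  "ctl_star_formula v \<phi> \<longleftrightarrow> (\<forall>c\<in>set_sfm \<phi>. assertion_over (set v \<times> {0}) c)"

definition all_preds :: "('f, 'r, 'p, 'x, 'e) program \<Rightarrow> ('f, 'r, 'p, 'x, 'e) fm sfm \<Rightarrow> 'p pred set" where
  "all_preds D \<phi> = preds (init D) \<union> preds (nxt D) \<union> (\<Union>j\<in>set (fair D). preds j) \<union>
    (\<Union>c\<in>set_sfm \<phi>. preds c)"

text \<open>
  \<open>app p v ns\<close> is the application of \<open>p\<close> to the copies of \<open>v\<close> listed in \<open>ns\<close>;
  for instance \<open>app r v [0, 1]\<close> is \<open>r(v, v')\<close>.
\<close>

definition app :: "'p \<Rightarrow> 'x list \<Rightarrow> nat list \<Rightarrow> ('f, 'r, 'p, 'x, 'e) fm" where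
  "app p v ns = Pred (p, length ns * length v) (concat (map (\<lambda>n. copy n v) ns))"

definition bvar :: "('f, 'r, 'x, 'e) background \<Rightarrow> 'x \<times> nat \<Rightarrow> ('f, 'r, 'p, 'x, 'e) fm" where
  "bvar T y = Eq (Var y) (Val (tt T))"

text \<open>
  \<open>monitor T x \<chi> \<delta> js\<close>: the boolean variable \<open>x\<close> stands for the temporal formula \<open>\<chi>\<close>,
  with conjunct \<open>\<delta>\<close> for the transition relation and new fairness conditions \<open>js\<close>.
\<close>

inductive monitor :: "('f, 'r, 'x, 'e) background \<Rightarrow> 'x \<Rightarrow> ('f, 'r, 'p, 'x, 'e) fm pfm \<Rightarrow>
    ('f, 'r, 'p, 'x, 'e) fm \<Rightarrow> ('f, 'r, 'p, 'x, 'e) fm list \<Rightarrow> bool"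
  for T :: "('f, 'r, 'x, 'e) background" and x :: 'x where
  monitor_X: "p_assn \<psi> c \<Longrightarrow>
    monitor T x (PX \<psi>) (Iff (bvar T (x, 0)) (shift 1 c)) []"
| monitor_G: "p_assn \<psi> c \<Longrightarrow>
    monitor T x (PG \<psi>) (Iff (bvar T (x, 0)) (Conj c (bvar T (x, 1))))
      [Disj (bvar T (x, 0)) (Neg c)]"
| monitor_U: "p_assn \<psi>\<^sub>1 c\<^sub>1 \<Longrightarrow> p_assn \<psi>\<^sub>2 c\<^sub>2 \<Longrightarrow>
    monitor T x (PU \<psi>\<^sub>1 \<psi>\<^sub>2) (Iff (bvar T (x, 0)) (Disj c\<^sub>2 (Conj c\<^sub>1 (bvar T (x, 1)))))
      [Disj (Neg (bvar T (x, 0))) c\<^sub>2]"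

text \<open>
  \<open>translate T N D \<phi> C N'\<close>: a run on \<open>D\<close> and \<open>\<phi>\<close> may produce the clauses \<open>C\<close>, where \<open>N\<close> and
  \<open>N'\<close> are the predicate symbols in use before and after the run. Freshness of a predicate is
  relative to \<open>N\<close>; a boolean variable is fresh if it is not among the program variables. The
  conditions \<open>J\<^sub>1, \<dots>, J\<^sub>k\<close> and the predicates \<open>q\<^sub>i, r\<^sub>i\<close> are indexed from 0 here.
\<close>

inductive translate :: "('f, 'r, 'x, 'e) background \<Rightarrow> 'p pred set \<Rightarrow>
    ('f, 'r, 'p, 'x, 'e) program \<Rightarrow> ('f, 'r, 'p, 'x, 'e) fm sfm \<Rightarrow>
    ('f, 'r, 'p, 'x, 'e) clause set \<Rightarrow> 'p pred set \<Rightarrow> bool"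
  for T :: "('f, 'r, 'x, 'e) background" where

  trans_basic:
  "\<lbrakk>p_qfree \<psi>; Quant Q \<psi> \<in> s_subs \<phi>; (aux, length v) \<notin> N;
    translate T (insert (aux, length v) N) (Program v (app aux v [0]) nx J) (Quant Q \<psi>) C\<^sub>1 N\<^sub>1;
    translate T N\<^sub>1 (Program v ini nx J) (s_repl (Quant Q \<psi>) (Asrt (app aux v [0])) \<phi>) C\<^sub>2 N\<^sub>2\<rbrakk>
   \<Longrightarrow> translate T N (Program v ini nx J) \<phi> (C\<^sub>1 \<union> C\<^sub>2) N\<^sub>2"

| trans_A:
  "\<lbrakk>p_qfree \<psi>; translate T N (Program v ini nx []) (Quant QAf \<psi>) C N'\<rbrakk>
   \<Longrightarrow> translate T N (Program v ini nx J) (Quant QA \<psi>) C N'"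

| trans_E:
  "\<lbrakk>p_qfree \<psi>; translate T N (Program v ini nx []) (Quant QEf \<psi>) C N'\<rbrakk>
   \<Longrightarrow> translate T N (Program v ini nx J) (Quant QE \<psi>) C N'"

| trans_Af_temporal:
  "\<lbrakk>p_qfree \<psi>; \<chi> \<in> t_subs \<psi>; monitor T x \<chi> \<delta> js;
    x \<notin> set v; rng T x = {tt T, ff T};
    translate T N (Program (v @ [x]) ini (Conj nx \<delta>) (J @ js))
      (Quant QAf (t_repl \<chi> (St (Asrt (bvar T (x, 0)))) \<psi>)) C N'\<rbrakk>
   \<Longrightarrow> translate T N (Program v ini nx J) (Quant QAf \<psi>) C N'"

| trans_Ef_temporal:
  "\<lbrakk>p_qfree \<psi>; \<chi> \<in> t_subs \<psi>; monitor T x \<chi> \<delta> js;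
    x \<notin> set v; rng T x = {tt T, ff T}; (aux, length v + 1) \<notin> N;
    translate T (insert (aux, length v + 1) N)
      (Program (v @ [x]) (app aux (v @ [x]) [0]) (Conj nx \<delta>) (J @ js))
      (Quant QEf (t_repl \<chi> (St (Asrt (bvar T (x, 0)))) \<psi>)) C N'\<rbrakk>
   \<Longrightarrow> translate T N (Program v ini nx J) (Quant QEf \<psi>)
        (insert (Imp ini (FEx (x, 0) (app aux (v @ [x]) [0]))) C) N'"

| trans_Af_fair:
  "\<lbrakk>p_assn \<psi> c; J \<noteq> []; k = length J;
    new = [(p, length v), (r, 2 * length v), (t, 2 * length v)];
    distinct new; set new \<inter> N = {}\<rbrakk>
   \<Longrightarrow> translate T N (Program v ini nx J) (Quant QAf \<psi>)
        {Imp (Conj ini (Neg c)) (app p v [0]),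
         Imp (Conj nx (app p v [0])) (app p v [1]),
         Imp (Conj (app p v [0])
               (conjs (map (\<lambda>i. Conj (app t v [i, i + 1]) (shift (i + 1) (J ! i))) [0..<k])))
             (app r v [0, k]),
         Dwf (r, 2 * length v),
         Imp nx (app t v [0, 1]),
         Imp (Conj (app t v [0, 1]) (shift 1 nx)) (app t v [0, 2])}
        (N \<union> set new)"

| trans_Af_unfair:
  "\<lbrakk>p_assn \<psi> c;
    new = [(p, length v), (r, 2 * length v), (t, 2 * length v)];
    distinct new; set new \<inter> N = {}\<rbrakk>
   \<Longrightarrow> translate T N (Program v ini nx []) (Quant QAf \<psi>)
        {Imp (Conj ini (Neg c)) (app p v [0]),
         Imp (Conj nx (app p v [0])) (app p v [1]),
         Imp (Conj (app p v [0]) (app t v [0, 1])) (app r v [0, 1]),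
         Dwf (r, 2 * length v),
         Imp nx (app t v [0, 1]),
         Imp (Conj (app t v [0, 1]) (shift 1 nx)) (app t v [0, 2])}
        (N \<union> set new)"

| trans_Ef_fair:
  "\<lbrakk>p_assn \<psi> c; J \<noteq> []; k = length J; length q = k; length r = k;
    new = map (\<lambda>a. (a, length v)) q @ map (\<lambda>a. (a, 2 * length v)) r;
    distinct new; set new \<inter> N = {}\<rbrakk>
   \<Longrightarrow> translate T N (Program v ini nx J) (Quant QEf \<psi>)
        ({Imp ini (Conj c (app (q ! 0) v [0]))} \<union>
         (\<Union>i<k.
           {Imp (app (q ! i) v [0])
              (exs v 1 (Conj nx
                (Disj (Conj (J ! i) (app (q ! ((i + 1) mod k)) v [1]))
                      (Conj (app (r ! i) v [0, 1]) (app (q ! i) v [1]))))),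
            Dwf (r ! i, 2 * length v),
            Imp (Conj (app (r ! i) v [0, 1]) (app (r ! i) v [1, 2])) (app (r ! i) v [0, 2])}))
        (N \<union> set new)"

| trans_Ef_unfair:
  "\<lbrakk>p_assn \<psi> c; (q, length v) \<notin> N\<rbrakk>
   \<Longrightarrow> translate T N (Program v ini nx []) (Quant QEf \<psi>)
        {Imp ini (Conj c (app q v [0])),
         Imp (app q v [0]) (exs v 1 (Conj nx (app q v [1])))}
        (insert (q, length v) N)"

| trans_assn:
  "s_assn \<phi> c \<Longrightarrow> translate T N (Program v ini nx J) \<phi> {Imp ini c} N"

definition Clauses :: "('f, 'r, 'x, 'e) background \<Rightarrow> ('f, 'r, 'p, 'x, 'e) program \<Rightarrow>
    ('f, 'r, 'p, 'x, 'e) fm sfm \<Rightarrow> ('f, 'r, 'p, 'x, 'e) clause set \<Rightarrow> bool" where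
  "Clauses T D \<phi> C \<longleftrightarrow> (\<exists>N'. translate T (all_preds D \<phi>) D \<phi> C N')"


section \<open>Synthesis\<close>

datatype 'e hole = Cond 'e 'e 'e | Assign 'e 'e

definition rvars :: "'x \<Rightarrow> ('f, 'r, 'p, 'x, 'e) program \<Rightarrow> 'x list" where
  "rvars pc P = removeAll pc (vars P)"

definition partial_program :: "('f, 'r, 'x, 'e) background \<Rightarrow> 'x \<Rightarrow>
    ('f, 'r, 'p, 'x, 'e) program \<Rightarrow> 'e hole list \<Rightarrow> bool" where
  "partial_program T pc P H \<longleftrightarrow> program P \<and> pc \<in> set (vars P) \<and>
    (\<forall>h\<in>set H. set_hole h \<subseteq> rng T pc)"

definition states :: "('f, 'r, 'x, 'e) background \<Rightarrow> 'x list \<Rightarrow> ('x \<Rightarrow> 'e) set" where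
  "states T v = PiE (set v) (rng T)"

definition tuples :: "('f, 'r, 'x, 'e) background \<Rightarrow> 'x list \<Rightarrow> 'e list set" where
  "tuples T v = {as. list_all2 (\<lambda>x a. a \<in> rng T x) v as}"

text \<open>
  Assertions contain no predicate symbols, so the interpretation used in \<open>holds\<close> and \<open>holds2\<close>
  is irrelevant.
\<close>

definition holds :: "('f, 'r, 'x, 'e) background \<Rightarrow> ('f, 'r, 'p, 'x, 'e) fm \<Rightarrow> ('x \<Rightarrow> 'e) \<Rightarrow> bool" where
  "holds T c s = eval T (\<lambda>_. {}) (\<lambda>(x, n). s x) c"

definition holds2 :: "('f, 'r, 'x, 'e) background \<Rightarrow> ('f, 'r, 'p, 'x, 'e) fm \<Rightarrow>
    ('x \<Rightarrow> 'e) \<Rightarrow> ('x \<Rightarrow> 'e) \<Rightarrow> bool" where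
  "holds2 T c s s' = eval T (\<lambda>_. {}) (\<lambda>(x, n). if n = 0 then s x else s' x) c"

text \<open>
  A resolving function is given by its restrictions \<open>\<Psi>c\<close> to condition holes and \<open>\<Psi>a\<close> to
  assignment holes.
\<close>

definition resolving :: "('f, 'r, 'x, 'e) background \<Rightarrow> 'x list \<Rightarrow> 'e hole list \<Rightarrow>
    ('e hole \<Rightarrow> 'e list set) \<Rightarrow> ('e hole \<Rightarrow> ('e list \<times> 'e list) set) \<Rightarrow> bool" where
  "resolving T vr H \<Psi>c \<Psi>a \<longleftrightarrow>
    (\<forall>l lt lf. Cond l lt lf \<in> set H \<longrightarrow> \<Psi>c (Cond l lt lf) \<subseteq> tuples T vr) \<and>
    (\<forall>l l'. Assign l l' \<in> set H \<longrightarrow> \<Psi>a (Assign l l') \<subseteq> tuples T vr \<times> tuples T vr \<and>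
      (\<forall>as\<in>tuples T vr. \<exists>bs\<in>tuples T vr. (as, bs) \<in> \<Psi>a (Assign l l')))"

definition synthesized :: "('f, 'r, 'x, 'e) background \<Rightarrow> 'x \<Rightarrow> ('f, 'r, 'p, 'x, 'e) program \<Rightarrow>
    'e hole list \<Rightarrow> ('e hole \<Rightarrow> 'e list set) \<Rightarrow> ('e hole \<Rightarrow> ('e list \<times> 'e list) set) \<Rightarrow>
    ('x \<Rightarrow> 'e) ts" where
  "synthesized T pc P H \<Psi>c \<Psi>a = (let S = states T (vars P); vr = rvars pc P in
    \<lparr>inits = {s\<in>S. holds T (init P) s},
     step = (\<lambda>s s'. s \<in> S \<and> s' \<in> S \<and>
       (holds2 T (nxt P) s s' \<or>
        (\<exists>l lt lf. Cond l lt lf \<in> set H \<and> s pc = l \<and> s' pc = lt \<and>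
           map s vr \<in> \<Psi>c (Cond l lt lf) \<and> map s' vr = map s vr) \<or>
        (\<exists>l lt lf. Cond l lt lf \<in> set H \<and> s pc = l \<and> s' pc = lf \<and>
           map s vr \<notin> \<Psi>c (Cond l lt lf) \<and> map s' vr = map s vr) \<or>
        (\<exists>l l'. Assign l l' \<in> set H \<and> s pc = l \<and> s' pc = l' \<and>
           (map s vr, map s' vr) \<in> \<Psi>a (Assign l l')))),
     fairness = map (holds T) (fair P)\<rparr>)"

definition realizable :: "('f, 'r, 'x, 'e) background \<Rightarrow> 'x \<Rightarrow> ('f, 'r, 'p, 'x, 'e) program \<Rightarrow>
    'e hole list \<Rightarrow> ('f, 'r, 'p, 'x, 'e) fm sfm \<Rightarrow> bool" where
  "realizable T pc P H \<phi> \<longleftrightarrow> (\<exists>\<Psi>c \<Psi>a. resolving T (rvars pc P) H \<Psi>c \<Psi>a \<and>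
    models (holds T) (synthesized T pc P H \<Psi>c \<Psi>a) \<phi>)"

text \<open>
  \<open>u h\<close> is the name of the predicate introduced for the hole \<open>h\<close>; it is applied to \<open>v\<^sub>r\<close> for a
  condition hole and to \<open>v\<^sub>r, v\<^sub>r'\<close> for an assignment hole.
\<close>

primrec hole_pred :: "('e hole \<Rightarrow> 'p) \<Rightarrow> 'x list \<Rightarrow> 'e hole \<Rightarrow> 'p pred" where
  "hole_pred u vr (Cond l lt lf) = (u (Cond l lt lf), length vr)"
| "hole_pred u vr (Assign l l') = (u (Assign l l'), 2 * length vr)"

definition next_U :: "'x \<Rightarrow> ('f, 'r, 'p, 'x, 'e) program \<Rightarrow> 'e hole list \<Rightarrow> ('e hole \<Rightarrow> 'p) \<Rightarrow>
    ('f, 'r, 'p, 'x, 'e) fm" where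
  "next_U pc P H u = (let vr = rvars pc P;
      frame = conjs (map (\<lambda>x. Eq (Var (x, 1)) (Var (x, 0))) vr);
      jump = (\<lambda>l l'. Conj (Eq (Var (pc, 0)) (Val l)) (Eq (Var (pc, 1)) (Val l')))
    in disjs ([nxt P] @
      [conjs [jump l lt, app (u (Cond l lt lf)) vr [0], frame]. Cond l lt lf \<leftarrow> H] @
      [conjs [jump l lf, Neg (app (u (Cond l lt lf)) vr [0]), frame]. Cond l lt lf \<leftarrow> H] @
      [conjs [jump l l', app (u (Assign l l')) vr [0, 1]]. Assign l l' \<leftarrow> H]))"

definition P_U :: "'x \<Rightarrow> ('f, 'r, 'p, 'x, 'e) program \<Rightarrow> 'e hole list \<Rightarrow> ('e hole \<Rightarrow> 'p) \<Rightarrow>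
    ('f, 'r, 'p, 'x, 'e) program" where
  "P_U pc P H u = Program (vars P) (init P) (next_U pc P H u) (fair P)"

definition Delta_a :: "'x \<Rightarrow> ('f, 'r, 'p, 'x, 'e) program \<Rightarrow> 'e hole list \<Rightarrow> ('e hole \<Rightarrow> 'p) \<Rightarrow>
    ('f, 'r, 'p, 'x, 'e) clause set" where
  "Delta_a pc P H u = {Imp Top (exs (rvars pc P) 1 (app (u (Assign l l')) (rvars pc P) [0, 1])) |
    l l'. Assign l l' \<in> set H}"

text \<open>
  \<open>Delta T pc P H \<phi> C\<close>: \<open>C\<close> is one of the clause sets that can be produced. Assertions contain
  no predicate symbols, so the hole predicates are fresh as soon as they are pairwise distinct.
\<close>

definition Delta :: "('f, 'r, 'x, 'e) background \<Rightarrow> 'x \<Rightarrow> ('f, 'r, 'p, 'x, 'e) program \<Rightarrow>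
    'e hole list \<Rightarrow> ('f, 'r, 'p, 'x, 'e) fm sfm \<Rightarrow> ('f, 'r, 'p, 'x, 'e) clause set \<Rightarrow> bool" where
  "Delta T pc P H \<phi> C \<longleftrightarrow> (\<exists>u C'. inj_on (hole_pred u (rvars pc P)) (set H) \<and>
    Clauses T (P_U pc P H u) \<phi> C' \<and> C = Delta_a pc P H u \<union> C')"

end

theory Submission
  imports Defs
begin

text \<open>
  By induction on the run of the translation, every interpretation of the predicates in use under
  which the program satisfies the formula extends to the fresh predicates so that the generated
  clauses hold. A fresh \<open>aux\<close> is interpreted as the set of states satisfying the subformula it
  stands for; a fresh boolean variable is the value of its temporal formula along the path, and the
  added fairness conditions make this the only solution of the added transition constraint. For
  \<open>A\<^sub>f c\<close>, \<open>p\<close> is reachability from an initial state violating \<open>c\<close>, \<open>t\<close> is the transitive closure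
  of the transition relation and \<open>r\<close> the body of its clause: an infinite \<open>r\<close>-chain would yield a
  fair path from a violating state. For \<open>E\<^sub>f c\<close>, every \<open>q\<^sub>i\<close> is the set of states with a fair
  path, and \<open>r\<^sub>i\<close> decreases the least position at which some fair path meets \<open>J\<^sub>i\<close>. The synthesis
  problem is the case where the hole predicates are interpreted by the resolving function.
\<close>

section \<open>Evaluation of assertions and clauses on states\<close>

text \<open>Replacing a subformula by \<open>aux(v)\<close> puts predicates into formulas and
  programs that began predicate free. Truth is therefore relative to an interpretation
  (\<open>hold\<close> instead of \<open>holds\<close>), and a run maintains that everything is
  \<open>over\<close> the predicates in use. Interpretations that agree on these induce the same
  transition system, so an extension to fresh predicates never disturbs what was established before.
  The choice for \<open>aux\<close> must be exact: its set is the initial condition of one sub-run,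
  which needs every member to satisfy the subformula, and a substitute in the other, which needs
  every satisfying state to be a member. For \<open>A\<^sub>f c\<close>, the relation
  \<open>r\<close> has to be cut down to states satisfying \<open>p\<close>, since fair paths may
  exist elsewhere. For \<open>E\<^sub>f c\<close>, no single path is tracked: a state with a fair
  path has a successor with one, and the progress towards each condition is measured by a rank of
  its own. All relations under \<open>dwf\<close> turn out well-founded by themselves, because a
  link through \<open>t\<close> unfolds into steps and ranks are natural numbers.\<close>

definition hold :: "('f, 'r, 'x, 'e) background \<Rightarrow> ('p pred \<Rightarrow> 'e list set) \<Rightarrow>
    ('f, 'r, 'p, 'x, 'e) fm \<Rightarrow> ('x \<Rightarrow> 'e) \<Rightarrow> bool" where
  "hold T I c s = eval T I (\<lambda>(x, n). s x) c"

definition hold2 :: "('f, 'r, 'x, 'e) background \<Rightarrow> ('p pred \<Rightarrow> 'e list set) \<Rightarrow>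
    ('f, 'r, 'p, 'x, 'e) fm \<Rightarrow> ('x \<Rightarrow> 'e) \<Rightarrow> ('x \<Rightarrow> 'e) \<Rightarrow> bool" where
  "hold2 T I c s s' = eval T I (\<lambda>(x, n). if n = 0 then s x else s' x) c"

text \<open>The restriction matters: states are extensional functions, so only a restricted slice is
  a member of \<open>states T v\<close>.\<close>

definition slice :: "'x list \<Rightarrow> ('x \<times> nat \<Rightarrow> 'e) \<Rightarrow> nat \<Rightarrow> 'x \<Rightarrow> 'e" where
  "slice v \<sigma> n = restrict (\<lambda>x. \<sigma> (x, n)) (set v)"

definition in_range :: "('f, 'r, 'x, 'e) background \<Rightarrow> ('x \<times> nat \<Rightarrow> 'e) \<Rightarrow> bool" where
  "in_range T \<sigma> \<longleftrightarrow> (\<forall>y. \<sigma> y \<in> rng T (fst y))"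

definition agree :: "'p pred set \<Rightarrow> ('p pred \<Rightarrow> 'e list set) \<Rightarrow> ('p pred \<Rightarrow> 'e list set) \<Rightarrow> bool" where
  "agree N I K \<longleftrightarrow> (\<forall>p\<in>N. I p = K p)"

text \<open>For \<open>N = {}\<close> this is \<open>assertion_over\<close>; a larger
  \<open>N\<close> admits hole predicates and those introduced during a run.\<close>

definition over :: "'p pred set \<Rightarrow> ('x \<times> nat) set \<Rightarrow> ('f, 'r, 'p, 'x, 'e) fm \<Rightarrow> bool" where
  "over N V c \<longleftrightarrow> preds c \<subseteq> N \<and> fvars c \<subseteq> V"

lemma tval_cong: "(\<And>y. y \<in> tvars t \<Longrightarrow> \<sigma> y = \<tau> y) \<Longrightarrow> tval T \<sigma> t = tval T \<tau> t"
proof (induction t)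
  case (Fn f ts)
  have "map (tval T \<sigma>) ts = map (tval T \<tau>) ts"
    using Fn by (intro map_cong) auto
  then show ?case by (simp only: tval.simps)
qed auto

lemma map_tval_cong:
  "(\<And>y. y \<in> \<Union> (tvars ` set ts) \<Longrightarrow> \<sigma> y = \<tau> y) \<Longrightarrow> map (tval T \<sigma>) ts = map (tval T \<tau>) ts"
  by (intro map_cong refl tval_cong) auto

lemma eval_cong:
  assumes "\<And>y. y \<in> fvars f \<Longrightarrow> \<sigma> y = \<tau> y" and "\<And>p. p \<in> preds f \<Longrightarrow> I p = K p"
  shows "eval T I \<sigma> f = eval T K \<tau> f"
  using assms
proof (induction f arbitrary: \<sigma> \<tau>)
  case (Eq s t)
  then have "tval T \<sigma> s = tval T \<tau> s" "tval T \<sigma> t = tval T \<tau> t"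
    by (auto intro!: tval_cong)
  then show ?case by simp
next
  case (Rel r ts)
  then have "map (tval T \<sigma>) ts = map (tval T \<tau>) ts"
    by (intro map_tval_cong) auto
  then show ?case by (simp only: eval.simps)
next
  case (Pred p ts)
  then have "map (tval T \<sigma>) ts = map (tval T \<tau>) ts"
    by (intro map_tval_cong) auto
  moreover have "I p = K p" using Pred by simp
  ultimately show ?case by (simp only: eval.simps)
next
  case (Neg f)
  then have "eval T I \<sigma> f = eval T K \<tau> f" by (intro Neg.IH) auto
  then show ?case by simp
next
  case (Conj f g)
  then have "eval T I \<sigma> f = eval T K \<tau> f" "eval T I \<sigma> g = eval T K \<tau> g"
    by (auto intro!: Conj.IH)
  then show ?case by simp
next
  case (Disj f g)
  then have "eval T I \<sigma> f = eval T K \<tau> f" "eval T I \<sigma> g = eval T K \<tau> g"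
    by (auto intro!: Disj.IH)
  then show ?case by simp
next
  case (FEx y f)
  then have "eval T I (\<sigma>(y := a)) f = eval T K (\<tau>(y := a)) f" for a
    by (intro FEx.IH) auto
  then show ?case by simp
next
  case (FAll y f)
  then have "eval T I (\<sigma>(y := a)) f = eval T K (\<tau>(y := a)) f" for a
    by (intro FAll.IH) auto
  then show ?case by simp
qed auto

lemma tval_tshift: "tval T \<sigma> (tshift k t) = tval T (\<lambda>(x, n). \<sigma> (x, n + k)) t"
proof (induction t)
  case (Fn f ts)
  then have "map (tval T \<sigma> \<circ> tshift k) ts = map (tval T (\<lambda>(x, n). \<sigma> (x, n + k))) ts"
    by (intro map_cong) auto
  then show ?case by (simp only: tshift.simps tval.simps map_map)
qed (auto split: prod.splits)

lemma map_tval_tshift: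
  "map (tval T \<sigma> \<circ> tshift k) ts = map (tval T (\<lambda>(x, n). \<sigma> (x, n + k))) ts"
  by (intro map_cong) (auto simp: tval_tshift)

text \<open>\<open>shift\<close> renames bound variables too, so in the quantifier cases an update
  at the shifted variable must become an update at the original one. Adding \<open>k\<close> is
  injective, so no other variable is hit.\<close>

lemma shift_update:
  fixes \<sigma> :: "'x \<times> nat \<Rightarrow> 'e"
  shows "(\<lambda>(x, n). (\<sigma>((fst y, snd y + k) := a)) (x, n + k)) = (\<lambda>(x, n). \<sigma> (x, n + k))(y := a)"
  by (cases y) (auto simp: fun_eq_iff)

lemma eval_shift: "eval T I \<sigma> (shift k f) = eval T I (\<lambda>(x, n). \<sigma> (x, n + k)) f"
proof (induction f arbitrary: \<sigma>)
  case (Rel r ts)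
  show ?case by (simp only: shift.simps eval.simps map_map map_tval_tshift)
next
  case (Pred p ts)
  show ?case by (simp only: shift.simps eval.simps map_map map_tval_tshift)
next
  case (FEx y f)
  show ?case by (simp only: shift.simps eval.simps FEx.IH shift_update[of \<sigma> y k] fst_conv)
next
  case (FAll y f)
  show ?case by (simp only: shift.simps eval.simps FAll.IH shift_update[of \<sigma> y k] fst_conv)
qed (simp_all add: tval_tshift)

section \<open>Valuations of clauses read as states\<close>

lemma states_slice: "in_range T \<sigma> \<Longrightarrow> slice v \<sigma> n \<in> states T v"
  by (auto simp: in_range_def slice_def states_def)

text \<open>Bridge between clauses, which quantify over valuations of all copies, and transition
  systems, whose points are states. Two interpretations occur because clauses are checked under an
  extension while the system is built from the interpretation given at the start.\<close>

lemma eval_slice: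
  assumes "over N (set v \<times> {0}) c" "agree N I K"
  shows "eval T I \<sigma> c = hold T K c (slice v \<sigma> 0)"
  unfolding hold_def using assms
  by (intro eval_cong) (auto simp: slice_def over_def agree_def)

lemma eval_slice_shift:
  assumes "over N (set v \<times> {0}) c" "agree N I K"
  shows "eval T I \<sigma> (shift k c) = hold T K c (slice v \<sigma> k)"
  unfolding hold_def eval_shift using assms
  by (intro eval_cong) (auto simp: slice_def over_def agree_def)

lemma eval_slice2:
  assumes "over N (set v \<times> {0, 1}) c" "agree N I K"
  shows "eval T I \<sigma> c = hold2 T K c (slice v \<sigma> 0) (slice v \<sigma> 1)"
  unfolding hold2_def using assms
  by (intro eval_cong) (auto simp: slice_def over_def agree_def)

lemma eval_slice2_shift:
  assumes "over N (set v \<times> {0, 1}) c" "agree N I K"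
  shows "eval T I \<sigma> (shift k c) = hold2 T K c (slice v \<sigma> k) (slice v \<sigma> (Suc k))"
  unfolding hold2_def eval_shift using assms
  by (intro eval_cong) (auto simp: slice_def over_def agree_def)

lemma hold_cong:
  "over N (set v \<times> {0}) c \<Longrightarrow> agree N I K \<Longrightarrow> (\<And>x. x \<in> set v \<Longrightarrow> s x = s' x) \<Longrightarrow>
    hold T I c s = hold T K c s'"
  unfolding hold_def by (intro eval_cong) (auto simp: over_def agree_def)

lemma hold2_cong:
  "over N (set v \<times> {0, 1}) c \<Longrightarrow> agree N I K \<Longrightarrow> (\<And>x. x \<in> set v \<Longrightarrow> s x = s' x) \<Longrightarrow>
    (\<And>x. x \<in> set v \<Longrightarrow> t x = t' x) \<Longrightarrow> hold2 T I c s t = hold2 T K c s' t'"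
  unfolding hold2_def by (intro eval_cong) (auto simp: over_def agree_def)

lemma eval_conjs: "eval T I \<sigma> (conjs fs) \<longleftrightarrow> (\<forall>f\<in>set fs. eval T I \<sigma> f)"
  by (induction fs) (auto simp: conjs_def)

lemma eval_disjs: "eval T I \<sigma> (disjs fs) \<longleftrightarrow> (\<exists>f\<in>set fs. eval T I \<sigma> f)"
  by (induction fs) (auto simp: disjs_def)

lemma eval_Iff: "eval T I \<sigma> (Iff f g) \<longleftrightarrow> eval T I \<sigma> f = eval T I \<sigma> g"
  by (auto simp: Iff_def)

lemma eval_app:
  "eval T I \<sigma> (app p v ns) \<longleftrightarrow>
    concat (map (\<lambda>n. map (slice v \<sigma> n) v) ns) \<in> I (p, length ns * length v)"
proof -
  have "map (tval T \<sigma>) (copy n v) = map (slice v \<sigma> n) v" for n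
    by (auto simp: copy_def slice_def)
  then show ?thesis by (simp add: app_def map_concat o_def)
qed

lemma eval_exs:
  "eval T I \<sigma> (exs v k f) \<longleftrightarrow>
    (\<exists>s\<in>states T v. eval T I (\<lambda>(x, n). if n = k \<and> x \<in> set v then s x else \<sigma> (x, n)) f)"
proof (induction v arbitrary: \<sigma>)
  case Nil
  have "(\<lambda>(x, n). \<sigma> (x, n)) = \<sigma>" by auto
  then show ?case by (simp add: exs_def states_def)
next
  case (Cons y v)
  let ?u = "\<lambda>\<sigma> v s. \<lambda>(x, n). if n = k \<and> x \<in> set v then s x else \<sigma> (x, n)"
  have "eval T I \<sigma> (exs (y # v) k f) \<longleftrightarrow>
      (\<exists>a\<in>rng T y. \<exists>s\<in>states T v. eval T I (?u (\<sigma>((y, k) := a)) v s) f)"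
    using Cons.IH by (simp add: exs_def del: fun_upd_apply)
  also have "\<dots> \<longleftrightarrow> (\<exists>s\<in>states T (y # v). eval T I (?u \<sigma> (y # v) s) f)"
  proof safe
    fix a s assume a: "a \<in> rng T y" "s \<in> states T v" "eval T I (?u (\<sigma>((y, k) := a)) v s) f"
    \<comment> \<open>If \<open>y\<close> recurs in \<open>v\<close>, the inner quantifier over it
      overrides the outer one, so the value in \<open>s\<close> prevails over
      \<open>a\<close>.\<close>
    let ?s = "if y \<in> set v then s else s(y := a)"
    have "?s \<in> states T (y # v)" using a by (auto simp: states_def PiE_def extensional_def Pi_def)
    moreover have "?u (\<sigma>((y, k) := a)) v s = ?u \<sigma> (y # v) ?s"
      by (auto simp: fun_eq_iff)
    ultimately show "\<exists>s\<in>states T (y # v). eval T I (?u \<sigma> (y # v) s) f"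
      using a(3) by auto
  next
    fix s assume s: "s \<in> states T (y # v)" "eval T I (?u \<sigma> (y # v) s) f"
    have r: "restrict s (set v) \<in> states T v" "s y \<in> rng T y" using s by (auto simp: states_def)
    have eq: "?u (\<sigma>((y, k) := s y)) v (restrict s (set v)) = ?u \<sigma> (y # v) s"
      by (auto simp: fun_eq_iff)
    show "\<exists>a\<in>rng T y. \<exists>s\<in>states T v. eval T I (?u (\<sigma>((y, k) := a)) v s) f"
      using s(2) by (intro bexI[OF _ r(2)] bexI[OF _ r(1)]) (simp only: eq)
  qed
  finally show ?case .
qed

section \<open>Predicates as sets of states\<close>

definition ext1 :: "('f, 'r, 'x, 'e) background \<Rightarrow> 'x list \<Rightarrow> (('x \<Rightarrow> 'e) \<Rightarrow> bool) \<Rightarrow> 'e list set" where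
  "ext1 T v Q = {map s v | s. s \<in> states T v \<and> Q s}"

definition ext2 :: "('f, 'r, 'x, 'e) background \<Rightarrow> 'x list \<Rightarrow>
    (('x \<Rightarrow> 'e) \<Rightarrow> ('x \<Rightarrow> 'e) \<Rightarrow> bool) \<Rightarrow> 'e list set" where
  "ext2 T v R = {map s v @ map s' v | s s'. s \<in> states T v \<and> s' \<in> states T v \<and> R s s'}"

text \<open>States are extensional on \<open>v\<close>, so the tuple of values determines the state.
  This is what allows a predicate to be interpreted by an arbitrary set of states.\<close>

lemma inj_states: "inj_on (\<lambda>s. map s v) (states T v)"
  by (auto simp: inj_on_def states_def intro: PiE_ext)

lemma map_in_ext1: "s \<in> states T v \<Longrightarrow> map s v \<in> ext1 T v Q \<longleftrightarrow> Q s"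
  unfolding ext1_def using inj_states[of v T] by (auto dest: inj_onD)

lemma map_in_ext2:
  "s \<in> states T v \<Longrightarrow> s' \<in> states T v \<Longrightarrow> map s v @ map s' v \<in> ext2 T v R \<longleftrightarrow> R s s'"
  unfolding ext2_def by (auto simp del: map_eq_conv dest: inj_onD[OF inj_states])

lemma length_ext1: "as \<in> ext1 T v Q \<Longrightarrow> length as = length v"
  by (auto simp: ext1_def)

lemma length_ext2: "as \<in> ext2 T v R \<Longrightarrow> length as = 2 * length v"
  by (auto simp: ext2_def)

lemma eval_app1:
  "I (p, length v) = ext1 T v Q \<Longrightarrow> in_range T \<sigma> \<Longrightarrow> eval T I \<sigma> (app p v [n]) \<longleftrightarrow> Q (slice v \<sigma> n)"
  by (simp add: eval_app map_in_ext1 states_slice)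

lemma eval_app2:
  "I (p, 2 * length v) = ext2 T v R \<Longrightarrow> in_range T \<sigma> \<Longrightarrow>
    eval T I \<sigma> (app p v [m, n]) \<longleftrightarrow> R (slice v \<sigma> m) (slice v \<sigma> n)"
  using map_in_ext2[of "slice v \<sigma> m" T v "slice v \<sigma> n" R]
  by (simp add: eval_app states_slice numeral_2_eq_2)

lemma sat_Imp:
  "sat_clause T I (Imp b h) \<longleftrightarrow> (\<forall>\<sigma>. in_range T \<sigma> \<longrightarrow> eval T I \<sigma> b \<longrightarrow> eval T I \<sigma> h)"
  by (auto simp: in_range_def)

text \<open>A well-founded relation is covered by a single component. The relation on tuples lies in
  the inverse image of the one on states under the decoding \<open>?g\<close>: both halves of a
  tuple have the same length, so it splits in only one way. The pairs are reversed because
  \<open>wf\<close> excludes infinite descent.\<close>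

lemma sat_Dwf:
  assumes "I (r, 2 * length v) = ext2 T v R" "wf {(s', s). s \<in> states T v \<and> s' \<in> states T v \<and> R s s'}"
  shows "sat_clause T I (Dwf (r, 2 * length v))"
proof -
  let ?W = "{(s', s). s \<in> states T v \<and> s' \<in> states T v \<and> R s s'}"
  let ?g = "inv_into (states T v) (\<lambda>s. map s v)"
  have g: "?g (map s v) = s" if "s \<in> states T v" for s
    using inv_into_f_f[OF inj_states that] by simp
  have "(bs, as) \<in> inv_image ?W ?g" if "(bs, as) \<in> (rel_of (I (r, 2 * length v)))\<inverse>" for as bs
  proof -
    obtain s s' where s: "s \<in> states T v" "s' \<in> states T v" "R s s'" "length as = length bs"
      "as @ bs = map s v @ map s' v"
      using \<open>(bs, as) \<in> _\<close> by (auto simp: rel_of_def assms(1) ext2_def)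
    have "length (as @ bs) = length (map s v @ map s' v)" by (simp only: s(5))
    with s(4) have "length as = length (map s v)" by simp
    with s(5) have "as = map s v \<and> bs = map s' v" 
      by (intro iffD1[OF append_eq_append_conv]) auto
    then show ?thesis using g s(1-3) by simp
  qed
  then have "(rel_of (I (r, 2 * length v)))\<inverse> \<subseteq> inv_image ?W ?g" by (intro subrelI)
  then have "wf ((rel_of (I (r, 2 * length v)))\<inverse>)"
    using assms(2) wf_subset wf_inv_image by blast
  then have "disj_wf ((rel_of (I (r, 2 * length v)))\<inverse>)"
    unfolding disj_wf_def by (intro exI[of _ "\<lambda>_. (rel_of (I (r, 2 * length v)))\<inverse>"] exI[of _ 1]) auto
  then show ?thesis by simp
qed

lemma interp_update:
  "interpretation_of_preds I \<Longrightarrow> A \<subseteq> {as. length as = n} \<Longrightarrow> interpretation_of_preds (I((p, n) := A))"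
  by (auto simp: interpretation_of_preds_def)

section \<open>Transition systems\<close>

text \<open>\<open>h n\<close> is the total length of the segments before the \<open>n\<close>-th,
  and position \<open>m\<close> belongs to segment \<open>idx m\<close>, the last one that starts at
  or before \<open>m\<close>. Positive lengths make \<open>h\<close> strictly increasing, so this
  segment exists and is unique.\<close>

lemma infinite_concat:
  fixes g :: "nat \<Rightarrow> 's"
  assumes L: "\<And>n. 0 < L n" and seg: "\<And>n. seg n 0 = g n" "\<And>n. seg n (L n) = g (Suc n)"
    "\<And>n i. i < L n \<Longrightarrow> E (seg n i) (seg n (Suc i))"
  shows "\<exists>\<pi> h. strict_mono (h :: nat \<Rightarrow> nat) \<and> h 0 = 0 \<and>
    (\<forall>n i. i \<le> L n \<longrightarrow> \<pi> (h n + i) = seg n i) \<and> (\<forall>i. E (\<pi> i) (\<pi> (Suc i)))"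
proof -
  define h where "h n = sum L {..<n}" for n
  have hS: "h (Suc n) = h n + L n" for n by (simp add: h_def)
  have mono: "strict_mono h" using L by (simp add: strict_mono_Suc_iff hS)
  define idx where "idx m = (GREATEST n. h n \<le> m)" for m
  have h_ge: "n \<le> h n" for n using strict_mono_imp_increasing[OF mono] .
  have idx: "h (idx m) \<le> m \<and> m < h (Suc (idx m))" for m
  proof -
    have 1: "h (idx m) \<le> m" unfolding idx_def
      by (rule GreatestI_nat[of _ 0 m]) (auto simp: h_def intro: order_trans[OF h_ge, unfolded h_def])
    have "Suc (idx m) \<le> idx m" if "h (Suc (idx m)) \<le> m"
      unfolding idx_def using that[unfolded idx_def]
      by (intro Greatest_le_nat[of _ _ m]) (auto intro: order_trans[OF h_ge])
    with 1 show ?thesis by fastforce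
  qed
  have idx_eq: "idx (h n + i) = n" if "i < L n" for n i
  proof -
    have "h n < h (Suc (idx (h n + i)))" "h (idx (h n + i)) < h (Suc n)"
      using idx[of "h n + i"] that by (simp_all add: hS[of n])
    then show ?thesis using strict_mono_less[OF mono] by simp
  qed
  define \<pi> where "\<pi> m = seg (idx m) (m - h (idx m))" for m
  have less: "\<pi> (h n + i) = seg n i" if "i < L n" for n i
    using that by (simp add: \<pi>_def idx_eq)
  \<comment> \<open>The end of segment \<open>n\<close> is indexed as position 0 of segment
    \<open>Suc n\<close>, so \<open>i = L n\<close> needs the matching of endpoints.\<close>
  have le: "\<pi> (h n + i) = seg n i" if "i \<le> L n" for n i
  proof (cases "i = L n")
    case True
    then show ?thesis using less[of 0 "Suc n"] L[of "Suc n"] seg by (simp add: hS)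
  next
    case False
    with that show ?thesis by (intro less) simp
  qed
  have "E (\<pi> m) (\<pi> (Suc m))" for m
  proof -
    let ?n = "idx m"
    have i: "m - h ?n < L ?n" "h ?n \<le> m" using idx[of m] by (auto simp: hS)
    have "\<pi> (h ?n + (m - h ?n)) = seg ?n (m - h ?n)" "\<pi> (h ?n + Suc (m - h ?n)) = seg ?n (Suc (m - h ?n))"
      using i by (intro le; simp)+
    then show ?thesis using seg(3)[OF i(1)] i(2) by (simp add: Suc_diff_le)
  qed
  moreover have "h 0 = 0" by (simp add: h_def)
  ultimately show ?thesis using mono le by (intro exI[of _ \<pi>] exI[of _ h]) simp
qed

text \<open>Every link unfolds into a finite run of steps. The strictly increasing \<open>h\<close>
  is exposed because whatever recurs along \<open>g\<close> has to recur at unboundedly late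
  positions of \<open>\<pi>\<close>.\<close>

lemma infinite_tranclp_chain:
  assumes "\<And>n. E\<^sup>+\<^sup>+ (g n) (g (Suc n))"
  shows "\<exists>\<pi> h. strict_mono (h :: nat \<Rightarrow> nat) \<and> h 0 = 0 \<and> (\<forall>n. \<pi> (h n) = g n) \<and>
    (\<forall>i. E (\<pi> i) (\<pi> (Suc i)))"
proof -
  have "\<exists>L seg. 0 < L \<and> seg 0 = g n \<and> seg L = g (Suc n) \<and> (\<forall>i<L. E (seg i) (seg (Suc i)))" for n
  proof -
    obtain L where "0 < L" "(E ^^ L) (g n) (g (Suc n))" using assms[of n] by (auto simp: tranclp_power)
    then show ?thesis by (auto simp: relpowp_fun_conv)
  qed
  then obtain L seg where seg: "\<And>n. 0 < L n" "\<And>n. seg n 0 = g n" "\<And>n. seg n (L n) = g (Suc n)"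
      "\<And>n i. i < L n \<Longrightarrow> E (seg n i) (seg n (Suc i))" by metis
  have "\<exists>\<pi> h. strict_mono (h :: nat \<Rightarrow> nat) \<and> h 0 = 0 \<and>
      (\<forall>n i. i \<le> L n \<longrightarrow> \<pi> (h n + i) = seg n i) \<and> (\<forall>i. E (\<pi> i) (\<pi> (Suc i)))"
    using seg by (intro infinite_concat)
  then obtain \<pi> h where \<pi>: "strict_mono (h :: nat \<Rightarrow> nat) \<and> h 0 = 0 \<and>
      (\<forall>n i. i \<le> L n \<longrightarrow> \<pi> (h n + i) = seg n i) \<and> (\<forall>i. E (\<pi> i) (\<pi> (Suc i)))"
    by (elim exE)
  then have "\<pi> (h n) = g n" for n using seg(2)[of n] by (metis add_0_right le0)
  with \<pi> show ?thesis by (intro exI[of _ \<pi>] exI[of _ h]) simp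
qed

section \<open>Fair paths, well-foundedness and ranks\<close>

definition has_fair_path :: "'s ts \<Rightarrow> 's \<Rightarrow> bool" where
  "has_fair_path M s \<longleftrightarrow> fair_paths M s \<noteq> {}"

lemma INFM_shift: "(\<exists>\<^sub>\<infinity>i. P (i + k)) \<longleftrightarrow> (\<exists>\<^sub>\<infinity>i. P (i :: nat))"
proof
  assume P: "\<exists>\<^sub>\<infinity>i. P (i + k)"
  have "\<exists>n\<ge>m. P n" for m
  proof -
    obtain n where "m \<le> n" "P (n + k)" using P unfolding INFM_nat_le by blast
    then show ?thesis by (intro exI[of _ "n + k"]) simp
  qed
  then show "\<exists>\<^sub>\<infinity>i. P i" unfolding INFM_nat_le by blast
next
  assume P: "\<exists>\<^sub>\<infinity>i. P i"
  have "\<exists>n\<ge>m. P (n + k)" for m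
  proof -
    obtain n where "m + k \<le> n" "P n" using P unfolding INFM_nat_le by blast
    then show ?thesis by (intro exI[of _ "n - k"]) simp
  qed
  then show "\<exists>\<^sub>\<infinity>i. P (i + k)" unfolding INFM_nat_le by blast
qed

lemma fair_paths_suffix: "\<pi> \<in> fair_paths M s \<Longrightarrow> (\<lambda>n. \<pi> (n + k)) \<in> fair_paths M (\<pi> k)"
  using INFM_shift[of "\<lambda>i. j (\<pi> i)" k for j] by (auto simp: fair_paths_def paths_def)

lemma fair_paths_Cons:
  assumes "step M s s'" "\<pi> \<in> fair_paths M s'"
  shows "case_nat s \<pi> \<in> fair_paths M s"
proof -
  have "step M (case_nat s \<pi> i) (case_nat s \<pi> (Suc i))" for i
    using assms by (cases i) (auto simp: fair_paths_def paths_def)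
  moreover have "\<exists>\<^sub>\<infinity>i. j (case_nat s \<pi> i)" if "j \<in> set (fairness M)" for j
    using INFM_shift[of "\<lambda>i. j (case_nat s \<pi> i)" 1] assms that by (simp add: fair_paths_def)
  ultimately show ?thesis by (auto simp: fair_paths_def paths_def)
qed

lemma has_fair_path_back: "(step M)\<^sup>*\<^sup>* s s' \<Longrightarrow> has_fair_path M s' \<Longrightarrow> has_fair_path M s"
  by (induction rule: converse_rtranclp_induct) (auto simp: has_fair_path_def dest: fair_paths_Cons)

text \<open>What the body of the clause for \<open>r\<close> says about its first and last copy once
  \<open>t\<close> is the transitive closure: nonempty runs whose endpoints meet the fairness
  conditions in order.\<close>

definition chain_through :: "('s \<Rightarrow> 's \<Rightarrow> bool) \<Rightarrow> ('s \<Rightarrow> bool) list \<Rightarrow> 's \<Rightarrow> 's \<Rightarrow> bool" where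
  "chain_through E js s s' \<longleftrightarrow> (\<exists>g. g 0 = s \<and> g (length js) = s' \<and>
    (\<forall>i<length js. E\<^sup>+\<^sup>+ (g i) (g (Suc i)) \<and> (js ! i) (g (Suc i))))"

text \<open>Each link of an infinite chain passes every fairness condition once, so the chain
  unfolds into a fair path from \<open>f 0\<close>, against \<open>no\<close>. Two gluings are
  needed: of the intermediate points of all links into one sequence \<open>w\<close>, and of the
  runs of steps between consecutive points of \<open>w\<close>.\<close>

lemma wf_chain_through:
  assumes "fairness M \<noteq> []" and no: "\<And>s. p s \<Longrightarrow> \<not> has_fair_path M s"
  shows "wf {(s', s). p s \<and> chain_through (step M) (fairness M) s s'}"
proof (rule ccontr)
  let ?js = "fairness M" let ?k = "length ?js"
  assume "\<not> wf {(s', s). p s \<and> chain_through (step M) ?js s s'}"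
  then obtain f where f: "\<And>n. p (f n)" "\<And>n. chain_through (step M) ?js (f n) (f (Suc n))"
    by (auto simp: wf_iff_no_infinite_down_chain)
  from f(2) have "\<forall>n. \<exists>g. g 0 = f n \<and> g ?k = f (Suc n) \<and>
      (\<forall>i<?k. (step M)\<^sup>+\<^sup>+ (g i) (g (Suc i)) \<and> (?js ! i) (g (Suc i)))"
    unfolding chain_through_def by blast
  from choice[OF this] obtain g where g: "\<And>n. g n 0 = f n" "\<And>n. g n ?k = f (Suc n)"
      "\<And>n i. i < ?k \<Longrightarrow> (step M)\<^sup>+\<^sup>+ (g n i) (g n (Suc i))" "\<And>n i. i < ?k \<Longrightarrow> (?js ! i) (g n (Suc i))"
    by blast
  have k: "\<And>n :: nat. 0 < ?k" using assms(1) by simp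
  then have "\<exists>w h. strict_mono (h :: nat \<Rightarrow> nat) \<and> h 0 = 0 \<and>
      (\<forall>n i. i \<le> ?k \<longrightarrow> w (h n + i) = g n i) \<and> (\<forall>i. (step M)\<^sup>+\<^sup>+ (w i) (w (Suc i)))"
    using g(1-3) by (intro infinite_concat[of "\<lambda>_. ?k" g f "(step M)\<^sup>+\<^sup>+"])
  then obtain w h where w: "strict_mono (h :: nat \<Rightarrow> nat)" "h 0 = 0"
    "\<And>n i. i \<le> ?k \<Longrightarrow> w (h n + i) = g n i" "\<And>i. (step M)\<^sup>+\<^sup>+ (w i) (w (Suc i))"
    by auto
  obtain \<pi> h' where \<pi>: "strict_mono (h' :: nat \<Rightarrow> nat)" "h' 0 = 0" "\<And>n. \<pi> (h' n) = w n"
    "\<And>i. step M (\<pi> i) (\<pi> (Suc i))"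
    using infinite_tranclp_chain[of "step M" w, OF w(4)] by auto
  have "\<exists>\<^sub>\<infinity>i. j (\<pi> i)" if j: "j \<in> set ?js" for j
  proof -
    obtain i where i: "i < ?k" "j = ?js ! i" using j by (auto simp: in_set_conv_nth)
    \<comment> \<open>Condition \<open>i\<close> is tested at the end of the \<open>i\<close>-th run
      of round \<open>n\<close>, hence the offset \<open>Suc i\<close>; \<open>h'\<close> carries
      positions of \<open>w\<close> to positions of \<open>\<pi>\<close>.\<close>
    have "j (\<pi> (h' (h n + Suc i)))" for n using g(4)[OF i(1)] w(3)[of "Suc i" n] i \<pi>(3) by simp
    moreover have "n \<le> h' (h n + Suc i)" for n
      using strict_mono_imp_increasing[OF w(1), where n = n]
        strict_mono_imp_increasing[OF \<pi>(1), where n = "h n + Suc i"] by simp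
    ultimately show ?thesis unfolding INFM_nat_le by metis
  qed
  moreover have "\<pi> 0 = f 0" using \<pi>(2) \<pi>(3)[of 0] w(2) w(3)[of 0 0] g(1) by simp
  ultimately have "\<pi> \<in> fair_paths M (f 0)" using \<pi>(4) by (auto simp: fair_paths_def paths_def)
  then show False using no[OF f(1)] by (auto simp: has_fair_path_def)
qed

text \<open>For an empty list \<open>chain_through\<close> degenerates to equality, so the case
  without fairness conditions is built on one nonempty run per link instead; every infinite path is
  fair here.\<close>

lemma wf_tranclp_unfair:
  assumes "fairness M = []" and no: "\<And>s. p s \<Longrightarrow> \<not> has_fair_path M s"
  shows "wf {(s', s). p s \<and> (step M)\<^sup>+\<^sup>+ s s'}"
proof (rule ccontr)
  assume "\<not> wf {(s', s). p s \<and> (step M)\<^sup>+\<^sup>+ s s'}"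
  then obtain f where f: "\<And>n. p (f n)" "\<And>n. (step M)\<^sup>+\<^sup>+ (f n) (f (Suc n))"
    by (auto simp: wf_iff_no_infinite_down_chain)
  obtain \<pi> h where \<pi>: "h 0 = (0 :: nat)" "\<And>n. \<pi> (h n) = f n" "\<And>i. step M (\<pi> i) (\<pi> (Suc i))"
    using infinite_tranclp_chain[of "step M" f, OF f(2)] by auto
  from \<pi>(1) \<pi>(2)[of 0] \<pi>(3) have "\<pi> \<in> fair_paths M (f 0)" using assms(1) by (auto simp: fair_paths_def paths_def)
  then show False using no[OF f(1)] by (auto simp: has_fair_path_def)
qed

text \<open>The minimum ranges over all fair paths from \<open>s\<close>, not along a chosen one, so
  it depends on the state alone. If no fair path meets \<open>j\<close>, the value is arbitrary,
  which is harmless: comparing any natural-number measure is transitive and well-founded.\<close>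

definition fair_rank :: "'s ts \<Rightarrow> ('s \<Rightarrow> bool) \<Rightarrow> 's \<Rightarrow> nat" where
  "fair_rank M j s = (LEAST n. \<exists>\<pi>\<in>fair_paths M s. j (\<pi> n))"

lemma fair_step:
  assumes "has_fair_path M s"
  shows "\<exists>s'. step M s s' \<and> has_fair_path M s'"
proof -
  obtain \<pi> where \<pi>: "\<pi> \<in> fair_paths M s" using assms by (auto simp: has_fair_path_def)
  then have "step M s (\<pi> 1)" by (auto simp: fair_paths_def paths_def)
  then show ?thesis using fair_paths_suffix[OF \<pi>, of 1] by (auto simp: has_fair_path_def)
qed

text \<open>Take the first step of a fair path that attains the rank. The rank is positive because
  \<open>j\<close> fails at \<open>s\<close>, and the tail, again fair, meets \<open>j\<close> one
  position earlier.\<close>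

lemma fair_rank_step:
  assumes "has_fair_path M s" "j \<in> set (fairness M)" "\<not> j s"
  shows "\<exists>s'. step M s s' \<and> has_fair_path M s' \<and> fair_rank M j s' < fair_rank M j s"
proof -
  obtain \<pi>0 where \<pi>0: "\<pi>0 \<in> fair_paths M s" using assms by (auto simp: has_fair_path_def)
  with assms(2) have "\<exists>\<^sub>\<infinity>i. j (\<pi>0 i)" by (auto simp: fair_paths_def)
  then obtain n where "j (\<pi>0 n)" using INFM_EX by blast
  with \<pi>0 have "\<exists>\<pi>\<in>fair_paths M s. j (\<pi> (fair_rank M j s))"
    unfolding fair_rank_def using LeastI[of "\<lambda>n. \<exists>\<pi>\<in>fair_paths M s. j (\<pi> n)" n] by blast
  then obtain \<pi> where \<pi>: "\<pi> \<in> fair_paths M s" "j (\<pi> (fair_rank M j s))" by blast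
  then have "\<pi> 0 = s" "step M s (\<pi> 1)" by (auto simp: fair_paths_def paths_def)
  with assms(3) \<pi>(2) obtain m where m: "fair_rank M j s = Suc m" by (cases "fair_rank M j s") auto
  have suf: "(\<lambda>n. \<pi> (n + 1)) \<in> fair_paths M (\<pi> 1)" using fair_paths_suffix[OF \<pi>(1)] .
  with \<pi>(2) m have "fair_rank M j (\<pi> 1) \<le> m" unfolding fair_rank_def
    by (intro Least_le) (auto intro!: bexI[OF _ suf])
  then show ?thesis using suf m \<open>step M s (\<pi> 1)\<close> by (auto simp: has_fair_path_def)
qed

section \<open>Substitution in temporal formulas and change of valuation\<close>

lemma s_subs_atoms:
  fixes \<phi> :: "'a sfm" and \<psi> :: "'a pfm"
  shows "a \<in> s_subs \<phi> \<Longrightarrow> set_sfm a \<subseteq> set_sfm \<phi>"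
    and "a \<in> p_subs \<psi> \<Longrightarrow> set_sfm a \<subseteq> set_pfm \<psi>"
  by (induction \<phi> and \<psi>) auto

lemma s_repl_atoms:
  fixes \<phi> :: "'a sfm" and \<psi> :: "'a pfm"
  shows "set_sfm (s_repl \<alpha> \<gamma> \<phi>) \<subseteq> set_sfm \<phi> \<union> set_sfm \<gamma>"
    and "set_pfm (p_repl \<alpha> \<gamma> \<psi>) \<subseteq> set_pfm \<psi> \<union> set_sfm \<gamma>"
  by (induction \<phi> and \<psi>) auto

lemma t_subs_atoms: "\<chi> \<in> t_subs \<psi> \<Longrightarrow> set_pfm \<chi> \<subseteq> set_pfm \<psi>"
  by (induction \<psi> rule: pfm.induct[of "\<lambda>_. True"]) auto

lemma t_repl_atoms: "set_pfm (t_repl \<chi> \<gamma> \<psi>) \<subseteq> set_pfm \<psi> \<union> set_pfm \<gamma>"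
  by (induction \<psi> rule: pfm.induct[of "\<lambda>_. True"]) auto

text \<open>Satisfaction at a state ignores initial states and looks only at the atoms that occur.
  This transfers formulas between interpretations that agree on the predicates in use, and between
  programs that differ in the initial condition.\<close>

lemma sat_cong:
  fixes \<phi> :: "'a sfm" and \<psi> :: "'a pfm"
  assumes "step M = step M'" "fairness M = fairness M'"
  shows "(\<And>c s. c \<in> set_sfm \<phi> \<Longrightarrow> val c s = val' c s) \<Longrightarrow> ssat val M \<phi> s = ssat val' M' \<phi> s"
    and "(\<And>c s. c \<in> set_pfm \<psi> \<Longrightarrow> val c s = val' c s) \<Longrightarrow> psat val M \<psi> \<pi> = psat val' M' \<psi> \<pi>"
proof -
  have [simp]: "paths M = paths M'" "fair_paths M = fair_paths M'"
    using assms by (auto simp: paths_def fair_paths_def fun_eq_iff)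
  show "(\<And>c s. c \<in> set_sfm \<phi> \<Longrightarrow> val c s = val' c s) \<Longrightarrow> ssat val M \<phi> s = ssat val' M' \<phi> s"
    and "(\<And>c s. c \<in> set_pfm \<psi> \<Longrightarrow> val c s = val' c s) \<Longrightarrow> psat val M \<psi> \<pi> = psat val' M' \<psi> \<pi>"
    by (induction \<phi> and \<psi> arbitrary: s and \<pi>) (auto split: quant.split)
qed

text \<open>Without path quantifiers the system is never consulted, so \<open>M\<close> and
  \<open>M'\<close> may be unrelated. This covers dropping the fairness list as well as comparing a
  path with its projection.\<close>

lemma qfree_sat_cong:
  fixes \<phi> :: "'a sfm" and \<psi> :: "'a pfm"
  shows "s_qfree \<phi> \<Longrightarrow> (\<And>c. c \<in> set_sfm \<phi> \<Longrightarrow> val c s = val' c s') \<Longrightarrow>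
      ssat val M \<phi> s = ssat val' M' \<phi> s'"
    and "p_qfree \<psi> \<Longrightarrow> (\<And>c i. c \<in> set_pfm \<psi> \<Longrightarrow> val c (\<pi> i) = val' c (\<pi>' i)) \<Longrightarrow>
      psat val M \<psi> \<pi> = psat val' M' \<psi> \<pi>'"
proof (induction \<phi> and \<psi> arbitrary: s s' and \<pi> \<pi>')
  case (PG p)
  then have "psat val M p (\<lambda>n. \<pi> (i + n)) = psat val' M' p (\<lambda>n. \<pi>' (i + n))" for i
    by (intro PG.IH) auto
  then show ?case by simp
next
  case (PU p q)
  then have "psat val M p (\<lambda>n. \<pi> (i + n)) = psat val' M' p (\<lambda>n. \<pi>' (i + n))"
      "psat val M q (\<lambda>n. \<pi> (i + n)) = psat val' M' q (\<lambda>n. \<pi>' (i + n))" for i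
    by (auto intro!: PU.IH)
  then show ?case by simp
qed (auto split: quant.split)

text \<open>The substitute matches the subformula only on the legal states \<open>S\<close>. That
  suffices, since every position of an infinite path has a successor and thus lies in
  \<open>S\<close>.\<close>

lemma sat_repl:
  fixes \<phi> :: "'a sfm" and \<psi> :: "'a pfm"
  assumes S: "\<And>s s'. step M s s' \<Longrightarrow> s \<in> S" and eq: "\<And>s. s \<in> S \<Longrightarrow> ssat val M \<gamma> s = ssat val M \<alpha> s"
  shows "s \<in> S \<Longrightarrow> ssat val M (s_repl \<alpha> \<gamma> \<phi>) s = ssat val M \<phi> s"
    and "(\<And>i. \<pi> i \<in> S) \<Longrightarrow> psat val M (p_repl \<alpha> \<gamma> \<psi>) \<pi> = psat val M \<psi> \<pi>"
proof (induction \<phi> and \<psi> arbitrary: s and \<pi>)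
  case (Quant q p)
  have "psat val M (p_repl \<alpha> \<gamma> p) \<pi> = psat val M p \<pi>" if "\<pi> \<in> paths M s" for \<pi>
    using that S by (intro Quant.IH) (auto simp: paths_def)
  then have "ssat val M (Quant q (p_repl \<alpha> \<gamma> p)) s = ssat val M (Quant q p) s"
    by (auto simp: fair_paths_def split: quant.split)
  then show ?case using eq[OF Quant.prems] by (cases "Quant q p = \<alpha>") auto
qed (use eq in auto)

text \<open>Occurrences of \<open>\<chi>\<close> may lie below other temporal operators, so
  \<open>X\<close> has to match \<open>\<chi>\<close> on every suffix. In the application
  \<open>\<pi>\<close> carries the additional variable and \<open>\<pi>'\<close> is its
  projection.\<close>

lemma psat_t_repl:
  assumes "p_qfree \<psi>" "\<And>a. \<chi> \<noteq> St a"
    "\<And>c i. c \<in> set_pfm \<psi> \<Longrightarrow> val c (\<pi> i) = val c (\<pi>' i)"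
    "\<And>i. val X (\<pi> i) = psat val M' \<chi> (\<lambda>n. \<pi>' (i + n))"
  shows "psat val M (t_repl \<chi> (St (Asrt X)) \<psi>) \<pi> = psat val M' \<psi> \<pi>'"
proof -
  have hit: "psat val M (St (Asrt X)) \<pi> = psat val M' \<chi> \<pi>'"
    if "\<And>i. val X (\<pi> i) = psat val M' \<chi> (\<lambda>n. \<pi>' (i + n))" for \<pi> \<pi>'
    using that[of 0] by simp
  show ?thesis using assms(1,3,4)
  proof (induction \<psi> arbitrary: \<pi> \<pi>' rule: pfm.induct[of "\<lambda>_. True"])
    case (St a)
    then have "ssat val M a (\<pi> 0) = ssat val M' a (\<pi>' 0)" by (intro qfree_sat_cong) auto
    with assms(2) show ?case by auto
  next
    case (PAnd p q)
    then have "psat val M (t_repl \<chi> (St (Asrt X)) p) \<pi> = psat val M' p \<pi>'"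
      "psat val M (t_repl \<chi> (St (Asrt X)) q) \<pi> = psat val M' q \<pi>'" by auto
    then show ?case using hit[OF PAnd.prems(3)] by (cases "PAnd p q = \<chi>") auto
  next
    case (POr p q)
    then have "psat val M (t_repl \<chi> (St (Asrt X)) p) \<pi> = psat val M' p \<pi>'"
      "psat val M (t_repl \<chi> (St (Asrt X)) q) \<pi> = psat val M' q \<pi>'" by auto
    then show ?case using hit[OF POr.prems(3)] by (cases "POr p q = \<chi>") auto
  next
    case (PX p)
    have "psat val M (t_repl \<chi> (St (Asrt X)) p) (\<lambda>n. \<pi> (Suc n)) = psat val M' p (\<lambda>n. \<pi>' (Suc n))"
      using PX.prems(1,2) PX.prems(3)[of "Suc i" for i] by (intro PX.IH) auto
    then show ?case using hit[OF PX.prems(3)] by (cases "PX p = \<chi>") auto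
  next
    case (PG p)
    have "psat val M (t_repl \<chi> (St (Asrt X)) p) (\<lambda>n. \<pi> (i + n)) = psat val M' p (\<lambda>n. \<pi>' (i + n))" for i
      using PG.prems(1,2) PG.prems(3)[of "i + j" for j] by (intro PG.IH) (auto simp: add.assoc)
    then show ?case using hit[OF PG.prems(3)] by (cases "PG p = \<chi>") auto
  next
    case (PU p q)
    have "psat val M (t_repl \<chi> (St (Asrt X)) p) (\<lambda>n. \<pi> (i + n)) = psat val M' p (\<lambda>n. \<pi>' (i + n))" for i
      using PU.prems(1,2) PU.prems(3)[of "i + j" for j] by (intro PU.IH) (auto simp: add.assoc)
    moreover have "psat val M (t_repl \<chi> (St (Asrt X)) q) (\<lambda>n. \<pi> (i + n)) = psat val M' q (\<lambda>n. \<pi>' (i + n))" for i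
      using PU.prems(1,2) PU.prems(3)[of "i + j" for j] by (intro PU.IH) (auto simp: add.assoc)
    ultimately show ?case using hit[OF PU.prems(3)] by (cases "PU p q = \<chi>") auto
  qed auto
qed

section \<open>Programs under an interpretation\<close>

lemma over_mono: "over N V c \<Longrightarrow> N \<subseteq> N' \<Longrightarrow> V \<subseteq> V' \<Longrightarrow> over N' V' c"
  by (auto simp: over_def)

lemma preds_shift: "preds (shift k f) = preds f"
  by (induction f) auto

lemma fvars_app: "fvars (app p v ns) = set v \<times> set ns"
  by (auto simp: app_def copy_def)

lemma preds_app: "preds (app p v ns) = {(p, length ns * length v)}"
  by (simp add: app_def)

lemma s_assn_over: "s_assn a c \<Longrightarrow> (\<And>d. d \<in> set_sfm a \<Longrightarrow> over N V d) \<Longrightarrow> over N V c"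
  by (induction rule: s_assn.induct) (auto simp: over_def)

lemma p_assn_over: "p_assn \<psi> c \<Longrightarrow> (\<And>d. d \<in> set_pfm \<psi> \<Longrightarrow> over N V d) \<Longrightarrow> over N V c"
  by (induction rule: p_assn.induct) (auto simp: over_def dest: s_assn_over[unfolded over_def])

lemma s_assn_sat: "s_assn a c \<Longrightarrow> ssat (hold T I) M a s = hold T I c s"
  by (induction rule: s_assn.induct) (auto simp: hold_def)

lemma p_assn_sat: "p_assn \<psi> c \<Longrightarrow> psat (hold T I) M \<psi> \<pi> = hold T I c (\<pi> 0)"
  by (induction rule: p_assn.induct) (auto simp: s_assn_sat, auto simp: hold_def)

lemma tvars_tshift: "tvars (tshift k t) = (\<lambda>y. (fst y, snd y + k)) ` tvars t"
  by (induction t) auto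

lemma fvars_shift: "fvars (shift k f) \<subseteq> (\<lambda>y. (fst y, snd y + k)) ` fvars f"
proof -
  have inj: "(fst y, snd y + k) = (fst z, snd z + k) \<longleftrightarrow> y = z" for y z :: "'x \<times> nat"
    by (auto simp: prod_eq_iff)
  show ?thesis by (induction f) (auto simp: tvars_tshift image_iff)
qed

lemma hold2_shift: "hold2 T I (shift 1 c) s s' = hold T I c s'"
  by (simp add: hold2_def hold_def eval_shift)

lemma hold2_hold:
  assumes "over N (V \<times> {0}) c"
  shows "hold2 T I c s s' = hold T I c s"
  unfolding hold2_def hold_def using assms by (intro eval_cong) (auto simp: over_def)

definition sem :: "('f, 'r, 'x, 'e) background \<Rightarrow> ('p pred \<Rightarrow> 'e list set) \<Rightarrow>
    ('f, 'r, 'p, 'x, 'e) program \<Rightarrow> ('x \<Rightarrow> 'e) ts" where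
  "sem T I D = \<lparr>inits = {s \<in> states T (vars D). hold T I (init D) s},
    step = (\<lambda>s s'. s \<in> states T (vars D) \<and> s' \<in> states T (vars D) \<and> hold2 T I (nxt D) s s'),
    fairness = map (hold T I) (fair D)\<rparr>"

lemma sem_simps [simp]:
  "inits (sem T I (Program v ini nx J)) = {s \<in> states T v. hold T I ini s}"
  "step (sem T I (Program v ini nx J)) s s' \<longleftrightarrow>
    s \<in> states T v \<and> s' \<in> states T v \<and> hold2 T I nx s s'"
  "fairness (sem T I (Program v ini nx J)) = map (hold T I) J"
  by (simp_all add: sem_def)

definition wf_prog :: "'p pred set \<Rightarrow> ('f, 'r, 'p, 'x, 'e) program \<Rightarrow> bool" where
  "wf_prog N D \<longleftrightarrow> over N (set (vars D) \<times> {0}) (init D) \<and> over N (set (vars D) \<times> {0, 1}) (nxt D) \<and>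
    (\<forall>j\<in>set (fair D). over N (set (vars D) \<times> {0}) j)"

lemma wf_prog_simps [simp]:
  "wf_prog N (Program v ini nx J) \<longleftrightarrow> over N (set v \<times> {0}) ini \<and> over N (set v \<times> {0, 1}) nx \<and>
    (\<forall>j\<in>set J. over N (set v \<times> {0}) j)"
  by (simp add: wf_prog_def)

lemma sem_cong: "wf_prog N D \<Longrightarrow> agree N I K \<Longrightarrow> sem T I D = sem T K D"
proof (cases D)
  case (Program v ini nx J)
  assume wf: "wf_prog N D" and ag: "agree N I K"
  have "hold T I c s = hold T K c s" if "over N (set v \<times> {0}) c" for c s
    using that ag by (rule hold_cong) simp
  moreover have "hold2 T I nx s s' = hold2 T K nx s s'" for s s'
    using wf ag by (intro hold2_cong[of N v]) (auto simp: Program)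
  ultimately show ?thesis using wf by (auto simp: sem_def fun_eq_iff Program)
qed

section \<open>Monitors\<close>

text \<open>The recurrence alone does not determine \<open>b\<close>: the constantly false sequence
  always solves it, even if \<open>c\<close> holds forever. Infinitely many positions with
  \<open>b\<close> or not \<open>c\<close> exclude this, since where \<open>c\<close> persists one
  later position with \<open>b\<close> carries \<open>b\<close> back along the recurrence.\<close>

lemma globally_monitor:
  "(\<forall>i. b i \<longleftrightarrow> c i \<and> b (Suc i)) \<and> (\<exists>\<^sub>\<infinity>i. b i \<or> \<not> c i) \<longleftrightarrow> (\<forall>i :: nat. b i \<longleftrightarrow> (\<forall>k. c (i + k)))"
proof (intro iffI)
  assume "(\<forall>i. b i \<longleftrightarrow> c i \<and> b (Suc i)) \<and> (\<exists>\<^sub>\<infinity>i. b i \<or> \<not> c i)"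
  then have step: "\<And>i. b i \<longleftrightarrow> c i \<and> b (Suc i)" and inf: "\<exists>\<^sub>\<infinity>i. b i \<or> \<not> c i" by blast+
  have fwd: "b i \<Longrightarrow> b (i + k)" for i k
  proof (induction k)
    case (Suc k)
    then show ?case using step[of "i + k"] by simp
  qed simp
  have bwd: "\<forall>j<k. c (i + j) \<Longrightarrow> b (i + k) \<Longrightarrow> b i" for i k
  proof (induction k)
    case (Suc k)
    moreover have "c (i + k)" using Suc.prems by simp
    ultimately show ?case using step[of "i + k"] by simp
  qed simp
  show "\<forall>i. b i \<longleftrightarrow> (\<forall>k. c (i + k))"
  proof (intro allI iffI)
    fix i k assume "b i" then show "c (i + k)" using fwd step by blast
  next
    fix i assume c: "\<forall>k. c (i + k)"
    obtain n where n: "i \<le> n" "b n \<or> \<not> c n" using inf unfolding INFM_nat_le by blast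
    then have "b (i + (n - i))" using c[rule_format, of "n - i"] by simp
    then show "b i" using bwd c by blast
  qed
next
  assume b: "\<forall>i. b i \<longleftrightarrow> (\<forall>k. c (i + k))"
  have "b i \<longleftrightarrow> c i \<and> b (Suc i)" for i
  proof -
    have "(\<forall>k. c (i + k)) \<longleftrightarrow> c (i + 0) \<and> (\<forall>k. c (i + Suc k))" using not0_implies_Suc by metis
    then show ?thesis using b by simp
  qed
  \<comment> \<open>At a position where \<open>b\<close> fails, some position from there on violates
    \<open>c\<close>.\<close>
  moreover have "\<exists>\<^sub>\<infinity>i. b i \<or> \<not> c i"
    unfolding INFM_nat_le using b by (metis le_add1 order_refl)
  ultimately show "(\<forall>i. b i \<longleftrightarrow> c i \<and> b (Suc i)) \<and> (\<exists>\<^sub>\<infinity>i. b i \<or> \<not> c i)" by blast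
qed

text \<open>Dual to the case of \<open>G\<close>: where \<open>c\<close> persists and
  \<open>d\<close> never comes, the recurrence also admits \<open>b\<close> constantly true, a
  promise postponed forever. Infinitely many positions with not \<open>b\<close> or \<open>d\<close>
  exclude it.\<close>

lemma until_monitor:
  "(\<forall>i. b i \<longleftrightarrow> d i \<or> c i \<and> b (Suc i)) \<and> (\<exists>\<^sub>\<infinity>i. \<not> b i \<or> d i) \<longleftrightarrow>
    (\<forall>i :: nat. b i \<longleftrightarrow> (\<exists>k. d (i + k) \<and> (\<forall>j<k. c (i + j))))"
  (is "?L \<longleftrightarrow> (\<forall>i. b i \<longleftrightarrow> ?U i)")
proof (intro iffI)
  assume "?L"
  then have step: "\<And>i. b i \<longleftrightarrow> d i \<or> c i \<and> b (Suc i)" and inf: "\<exists>\<^sub>\<infinity>i. \<not> b i \<or> d i" by blast+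
  have bwd: "\<forall>j<k. c (i + j) \<Longrightarrow> b (i + k) \<Longrightarrow> b i" for i k
  proof (induction k)
    case (Suc k)
    moreover have "c (i + k)" using Suc.prems by simp
    ultimately show ?case using step[of "i + k"] by simp
  qed simp
  \<comment> \<open>Unfolding the recurrence \<open>k\<close> times: either \<open>d\<close> has
    been reached in time, or the obligation has moved on to \<open>i + k\<close>.\<close>
  have fwd: "?U i \<or> (\<forall>j<k. c (i + j)) \<and> b (i + k)" if "b i" for i k
  proof (induction k)
    case 0
    then show ?case using that by simp
  next
    case (Suc k)
    then show ?case
    proof
      assume k: "(\<forall>j<k. c (i + j)) \<and> b (i + k)"
      show ?thesis
      proof (cases "d (i + k)")
        case True
        with k show ?thesis by blast
      next
        case False
        with k step[of "i + k"] show ?thesis by (auto simp: less_Suc_eq)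
      qed
    qed blast
  qed
  show "\<forall>i. b i \<longleftrightarrow> ?U i"
  proof (intro allI iffI)
    fix i assume i: "b i"
    obtain n where n: "i \<le> n" "\<not> b n \<or> d n" using inf unfolding INFM_nat_le by blast
    show "?U i"
    proof (rule disjE[OF fwd[OF i, of "n - i"]])
      assume "(\<forall>j<n - i. c (i + j)) \<and> b (i + (n - i))"
      moreover from this have "d (i + (n - i))" using n by simp
      ultimately show ?thesis by blast
    qed
  next
    fix i assume "?U i"
    then obtain k where "d (i + k)" "\<forall>j<k. c (i + j)" by blast
    then show "b i" using bwd step by blast
  qed
next
  assume b: "\<forall>i. b i \<longleftrightarrow> ?U i"
  have "b i \<longleftrightarrow> d i \<or> c i \<and> b (Suc i)" for i
  proof
    assume "b i"
    then obtain k where k: "d (i + k)" "\<forall>j<k. c (i + j)" using b by blast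
    show "d i \<or> c i \<and> b (Suc i)"
    proof (cases k)
      case 0
      then show ?thesis using k by simp
    next
      case (Suc m)
      have "c (Suc i + j)" if "j < m" for j using k(2)[rule_format, of "Suc j"] that Suc by simp
      moreover have "d (Suc i + m)" "c i" using k Suc k(2)[rule_format, of 0] by auto
      ultimately show ?thesis using b by blast
    qed
  next
    assume "d i \<or> c i \<and> b (Suc i)"
    then show "b i"
    proof
      assume "d i"
      then have "d (i + 0) \<and> (\<forall>j<0. c (i + j))" by simp
      then show ?thesis using b by blast
    next
      assume i: "c i \<and> b (Suc i)"
      then obtain k where "d (Suc i + k)" "\<forall>j<k. c (Suc i + j)" using b by blast
      with i have "d (i + Suc k) \<and> (\<forall>j<Suc k. c (i + j))" by (auto simp: less_Suc_eq_0_disj)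
      then show ?thesis using b by blast
    qed
  qed
  moreover have "\<exists>\<^sub>\<infinity>i. \<not> b i \<or> d i"
    unfolding INFM_nat_le
  proof
    fix m
    show "\<exists>n\<ge>m. \<not> b n \<or> d n"
    proof (cases "b m")
      case True
      then obtain k where "d (m + k)" using b by blast
      then show ?thesis using le_add1 by blast
    qed blast
  qed
  ultimately show ?L by blast
qed

text \<open>Both directions matter: paths of the extended program that meet the added conditions
  carry the true values of \<open>\<chi>\<close>, and a path equipped with the true values meets
  them. For \<open>X\<close> the transition constraint already fixes the value, so no fairness
  condition is added.\<close>

lemma monitor_correct:
  assumes "monitor T x \<chi> \<delta> js" "\<And>c. c \<in> set_pfm \<chi> \<Longrightarrow> over N (V \<times> {0}) c"
  shows "(\<forall>i. hold2 T I \<delta> (\<pi> i) (\<pi> (Suc i))) \<and> (\<forall>j\<in>set js. \<exists>\<^sub>\<infinity>i. hold T I j (\<pi> i)) \<longleftrightarrow>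
    (\<forall>i. \<pi> i x = tt T \<longleftrightarrow> psat (hold T I) M \<chi> (\<lambda>n. \<pi> (i + n)))"
  using assms
proof cases
  case (monitor_X \<psi> c)
  have "hold2 T I \<delta> s s' \<longleftrightarrow> (s x = tt T \<longleftrightarrow> hold T I c s')" for s s'
    using hold2_shift[of T I c s s'] by (simp add: monitor_X hold2_def eval_Iff bvar_def)
  then show ?thesis using monitor_X by (simp add: p_assn_sat)
next
  case (monitor_G \<psi> c)
  have c: "over N (V \<times> {0}) c" using p_assn_over monitor_G assms(2) by fastforce
  have "hold2 T I \<delta> s s' \<longleftrightarrow> (s x = tt T \<longleftrightarrow> hold T I c s \<and> s' x = tt T)" for s s'
    using hold2_hold[OF c, of T I s s'] by (simp add: monitor_G hold2_def eval_Iff bvar_def)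
  moreover have "hold T I (js ! 0) s \<longleftrightarrow> s x = tt T \<or> \<not> hold T I c s" for s
    by (simp add: monitor_G hold_def bvar_def)
  ultimately show ?thesis
    using globally_monitor[of "\<lambda>i. \<pi> i x = tt T" "\<lambda>i. hold T I c (\<pi> i)"] monitor_G
    by (simp add: p_assn_sat)
next
  case (monitor_U \<psi>\<^sub>1 c\<^sub>1 \<psi>\<^sub>2 c\<^sub>2)
  have c: "over N (V \<times> {0}) c\<^sub>1" "over N (V \<times> {0}) c\<^sub>2" using p_assn_over monitor_U assms(2) by fastforce+
  have "hold2 T I \<delta> s s' \<longleftrightarrow> (s x = tt T \<longleftrightarrow> hold T I c\<^sub>2 s \<or> hold T I c\<^sub>1 s \<and> s' x = tt T)" for s s'
    using hold2_hold[OF c(1), of T I s s'] hold2_hold[OF c(2), of T I s s']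
    by (simp add: monitor_U hold2_def eval_Iff bvar_def)
  moreover have "hold T I (js ! 0) s \<longleftrightarrow> s x \<noteq> tt T \<or> hold T I c\<^sub>2 s" for s
    by (simp add: monitor_U hold_def bvar_def)
  ultimately show ?thesis
    using until_monitor[of "\<lambda>i. \<pi> i x = tt T" "\<lambda>i. hold T I c\<^sub>2 (\<pi> i)" "\<lambda>i. hold T I c\<^sub>1 (\<pi> i)"] monitor_U
    by (simp add: p_assn_sat)
qed

lemma monitor_over:
  assumes "monitor T x \<chi> \<delta> js" "\<And>c. c \<in> set_pfm \<chi> \<Longrightarrow> over N (set v \<times> {0}) c"
  shows "over N (set (v @ [x]) \<times> {0, 1}) \<delta>" "\<forall>j\<in>set js. over N (set (v @ [x]) \<times> {0}) j"
proof -
  have "over N (set (v @ [x]) \<times> {0, 1}) \<delta> \<and> (\<forall>j\<in>set js. over N (set (v @ [x]) \<times> {0}) j)"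
    using assms
  proof cases
    case (monitor_X \<psi> c)
    have "over N (set v \<times> {0}) c" using p_assn_over monitor_X assms(2) by fastforce
    then have "fvars (shift 1 c) \<subseteq> set v \<times> {1}" "preds (shift 1 c) \<subseteq> N"
      using fvars_shift[of 1 c] by (fastforce simp: over_def preds_shift)+
    then show ?thesis by (auto simp: monitor_X over_def Iff_def bvar_def)
  next
    case (monitor_G \<psi> c)
    have "over N (set v \<times> {0}) c" using p_assn_over monitor_G assms(2) by fastforce
    then show ?thesis by (auto simp: monitor_G over_def Iff_def bvar_def)
  next
    case (monitor_U \<psi>\<^sub>1 c\<^sub>1 \<psi>\<^sub>2 c\<^sub>2)
    have "over N (set v \<times> {0}) c\<^sub>1" "over N (set v \<times> {0}) c\<^sub>2"
      using p_assn_over monitor_U assms(2) by fastforce+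
    then show ?thesis by (auto simp: monitor_U over_def Iff_def bvar_def)
  qed
  then show "over N (set (v @ [x]) \<times> {0, 1}) \<delta>" "\<forall>j\<in>set js. over N (set (v @ [x]) \<times> {0}) j" by auto
qed

lemma monitor_not_St: "monitor T x \<chi> \<delta> js \<Longrightarrow> \<chi> \<noteq> St a"
  by (auto elim: monitor.cases)

lemma t_subs_qfree: "\<chi> \<in> t_subs \<psi> \<Longrightarrow> p_qfree \<psi> \<Longrightarrow> p_qfree \<chi>"
  by (induction \<psi> rule: pfm.induct[of "\<lambda>_. True"]) auto

text \<open>Common setting of the two temporal rules. The initial condition \<open>ini'\<close> of
  the extended program is left open, since the rule for \<open>A\<^sub>f\<close> keeps
  \<open>ini\<close> while the rule for \<open>E\<^sub>f\<close> starts from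
  \<open>aux\<close>.\<close>

locale monitored =
  fixes T :: "('f, 'r, 'x, 'e) background" and N :: "'p pred set" and I :: "'p pred \<Rightarrow> 'e list set"
    and v :: "'x list" and ini ini' nx \<delta> :: "('f, 'r, 'p, 'x, 'e) fm" and J js and x :: 'x
    and \<psi> \<chi> :: "('f, 'r, 'p, 'x, 'e) fm pfm"
  assumes distinct_bools: "tt T \<noteq> ff T"
    and wf: "wf_prog N (Program v ini nx J)"
    and qfree: "p_qfree \<psi>" and sub: "\<chi> \<in> t_subs \<psi>" and mon: "monitor T x \<chi> \<delta> js"
    and fresh: "x \<notin> set v" and bool: "rng T x = {tt T, ff T}"
    and atoms: "\<And>c. c \<in> set_pfm \<psi> \<Longrightarrow> over N (set v \<times> {0}) c"
begin

abbreviation "M \<equiv> sem T I (Program v ini nx J)"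
abbreviation "M' \<equiv> sem T I (Program (v @ [x]) ini' (Conj nx \<delta>) (J @ js))"
abbreviation "\<psi>' \<equiv> t_repl \<chi> (St (Asrt (bvar T (x, 0)))) \<psi>"
abbreviation "proj s \<equiv> restrict s (set v)"

lemma atoms_sub: "c \<in> set_pfm \<chi> \<Longrightarrow> over N (set v \<times> {0}) c"
  using atoms t_subs_atoms[OF sub] by blast

lemma hold_proj: "over N (set v \<times> {0}) c \<Longrightarrow> hold T I c (proj s) = hold T I c s"
  by (rule hold_cong[of N v]) (auto simp: agree_def)

lemma hold2_proj: "hold2 T I nx (proj s) (proj s') = hold2 T I nx s s'"
  using wf by (intro hold2_cong[of N v]) (auto simp: agree_def)

lemma states_proj: "s \<in> states T (v @ [x]) \<Longrightarrow> proj s \<in> states T v"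
  by (auto simp: states_def)

lemma psat_proj:
  assumes "p_qfree \<xi>" "\<And>c. c \<in> set_pfm \<xi> \<Longrightarrow> over N (set v \<times> {0}) c"
  shows "psat (hold T I) M \<xi> (\<lambda>n. proj (\<pi> n)) = psat (hold T I) M' \<xi> \<pi>"
  using assms by (intro qfree_sat_cong) (auto simp: hold_proj)

text \<open>By \<open>monitor_correct\<close>, \<open>\<delta>\<close> and \<open>js\<close>
  together say that \<open>x\<close> carries the value of \<open>\<chi>\<close>. All other
  constraints speak about \<open>v\<close> only and so transfer to the projection. Hence a fair path
  of the original program has exactly one annotation by \<open>x\<close> up to the encoding of truth
  values.\<close>

lemma fair_paths_iff:
  "\<pi> \<in> fair_paths M' (\<pi> 0) \<longleftrightarrow> (\<forall>i. \<pi> i \<in> states T (v @ [x])) \<and>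
    (\<lambda>i. proj (\<pi> i)) \<in> fair_paths M (proj (\<pi> 0)) \<and>
    (\<forall>i. \<pi> i x = tt T \<longleftrightarrow> psat (hold T I) M \<chi> (\<lambda>n. proj (\<pi> (i + n))))"
proof -
  have "psat (hold T I) M \<chi> (\<lambda>n. proj (\<pi> (i + n))) = psat (hold T I) M' \<chi> (\<lambda>n. \<pi> (i + n))" for i
    using psat_proj[of \<chi> "\<lambda>n. \<pi> (i + n)"] t_subs_qfree[OF sub qfree] atoms_sub by blast
  then have m: "(\<forall>i. \<pi> i x = tt T \<longleftrightarrow> psat (hold T I) M \<chi> (\<lambda>n. proj (\<pi> (i + n)))) \<longleftrightarrow>
      (\<forall>i. hold2 T I \<delta> (\<pi> i) (\<pi> (Suc i))) \<and> (\<forall>j\<in>set js. \<exists>\<^sub>\<infinity>i. hold T I j (\<pi> i))"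
    using monitor_correct[OF mon atoms_sub, of I \<pi> M'] by simp
  have h: "hold2 T I (Conj nx \<delta>) s s' \<longleftrightarrow> hold2 T I nx s s' \<and> hold2 T I \<delta> s s'" for s s'
    by (simp add: hold2_def)
  have J: "(\<exists>\<^sub>\<infinity>i. hold T I j (proj (\<pi> i))) = (\<exists>\<^sub>\<infinity>i. hold T I j (\<pi> i))" if "j \<in> set J" for j
    using hold_proj wf that by simp
  show ?thesis unfolding m
    using states_proj J
    by (auto simp: fair_paths_def paths_def h hold2_proj)
qed

lemma psat_monitored:
  assumes "\<pi> \<in> fair_paths M' (\<pi> 0)"
  shows "psat (hold T I) M' \<psi>' \<pi> = psat (hold T I) M \<psi> (\<lambda>i. proj (\<pi> i))"
proof (rule psat_t_repl[OF qfree])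
  show "\<chi> \<noteq> St a" for a using monitor_not_St[OF mon] .
  show "hold T I c (\<pi> i) = hold T I c (proj (\<pi> i))" if "c \<in> set_pfm \<psi>" for c i
    using hold_proj[OF atoms[OF that]] by simp
  show "hold T I (bvar T (x, 0)) (\<pi> i) = psat (hold T I) M \<chi> (\<lambda>n. proj (\<pi> (i + n)))" for i
    using assms fair_paths_iff by (simp add: hold_def bvar_def)
qed

lemma lift_fair_path:
  assumes \<rho>: "\<rho> \<in> fair_paths M s" and s: "s \<in> states T v"
  obtains \<pi> where "\<pi> \<in> fair_paths M' (\<pi> 0)" "\<And>i. proj (\<pi> i) = \<rho> i" "\<And>i. \<pi> i \<in> states T (v @ [x])"
proof -
  \<comment> \<open>The annotation forced by the monitor; since \<open>tt T\<close> and
    \<open>ff T\<close> differ, comparing \<open>x\<close> with \<open>tt T\<close> recovers the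
    truth value.\<close>
  define \<pi> where "\<pi> i = (\<rho> i)(x := if psat (hold T I) M \<chi> (\<lambda>n. \<rho> (i + n)) then tt T else ff T)" for i
  have \<rho>S: "\<rho> i \<in> states T v" for i using \<rho> by (auto simp: fair_paths_def paths_def)
  have \<pi>S: "\<pi> i \<in> states T (v @ [x])" for i
    using \<rho>S[of i] bool by (auto simp: states_def \<pi>_def PiE_def Pi_def extensional_def)
  have p: "proj (\<pi> i) = \<rho> i" for i
    using \<rho>S[of i] fresh by (auto simp: states_def \<pi>_def PiE_def extensional_def fun_eq_iff)
  have "\<rho> \<in> fair_paths M (\<rho> 0)" using \<rho> by (auto simp: fair_paths_def paths_def)
  then have "\<pi> \<in> fair_paths M' (\<pi> 0)"
    unfolding fair_paths_iff p using \<pi>S distinct_bools by (simp add: \<pi>_def)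
  then show thesis using that p \<pi>S by blast
qed

lemma wf_monitored:
  assumes "N \<subseteq> N'" "over N' (set (v @ [x]) \<times> {0}) ini'"
  shows "wf_prog N' (Program (v @ [x]) ini' (Conj nx \<delta>) (J @ js))"
proof -
  have "over N (set (v @ [x]) \<times> {0, 1}) nx" "\<forall>j\<in>set J. over N (set (v @ [x]) \<times> {0}) j"
    using wf by (auto intro: over_mono)
  with monitor_over[OF mon atoms_sub] assms show ?thesis by (auto simp: over_def)
qed

lemma atoms_monitored:
  assumes "N \<subseteq> N'" "c \<in> set_pfm \<psi>'"
  shows "over N' (set (v @ [x]) \<times> {0}) c"
proof -
  have "c \<in> set_pfm \<psi> \<or> c = bvar T (x, 0)" using t_repl_atoms[of \<chi> _ \<psi>] assms(2) by fastforce
  then show ?thesis using assms(1) atoms[of c] by (auto simp: over_def bvar_def)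
qed

end

section \<open>Satisfying the generated clauses\<close>

text \<open>
  The clauses are required to hold under every \<open>L\<close> agreeing with \<open>K\<close> on the predicates in use
  after the run, so that later runs may reinterpret the remaining ones.
\<close>

definition extends_to :: "('f, 'r, 'x, 'e) background \<Rightarrow> 'p pred set \<Rightarrow> 'p pred set \<Rightarrow>
    ('p pred \<Rightarrow> 'e list set) \<Rightarrow> ('f, 'r, 'p, 'x, 'e) clause set \<Rightarrow> bool" where
  "extends_to T N N' I C \<longleftrightarrow> (\<exists>K. interpretation_of_preds K \<and> agree N K I \<and>
    (\<forall>L. agree N' L K \<longrightarrow> (\<forall>c\<in>C. sat_clause T L c)))"

text \<open>Hides the updated valuation behind its two slices, so that heads with existential
  quantifiers are checked by the same evaluation lemmas as all other formulas.\<close>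

lemma slice_next:
  assumes "in_range T \<sigma>" "s \<in> states T v"
    and "\<And>\<tau>. in_range T \<tau> \<Longrightarrow> slice v \<tau> 0 = slice v \<sigma> 0 \<Longrightarrow> slice v \<tau> 1 = s \<Longrightarrow> eval T I \<tau> f"
  shows "eval T I \<sigma> (exs v 1 f)"
proof -
  let ?\<tau> = "\<lambda>(x, n). if n = 1 \<and> x \<in> set v then s x else \<sigma> (x, n)"
  have "in_range T ?\<tau>" using assms(1,2) by (auto simp: in_range_def states_def)
  moreover have "slice v ?\<tau> 0 = slice v \<sigma> 0" by (auto simp: slice_def fun_eq_iff)
  moreover have "slice v ?\<tau> 1 = s"
    using assms(2) by (auto simp: slice_def fun_eq_iff states_def PiE_def extensional_def)
  ultimately show ?thesis using assms(2,3) unfolding eval_exs by blast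
qed

text \<open>The two forms of the rule differ only in the clause for \<open>r\<close>, so its body,
  the relation \<open>R\<close> that the body forces and the last copy \<open>k\<close> are
  parameters. \<open>wfR\<close> is required for every \<open>Q\<close> that excludes fair paths,
  because the actual \<open>Q\<close> is chosen inside the proof.\<close>

lemma Af_clauses:
  fixes T :: "('f, 'r, 'x, 'e) background" and I :: "'p pred \<Rightarrow> 'e list set"
    and v :: "'x list" and ini nx :: "('f, 'r, 'p, 'x, 'e) fm" and J :: "('f, 'r, 'p, 'x, 'e) fm list"
  defines "M \<equiv> sem T I (Program v ini nx J)"
  assumes psi: "p_assn \<psi> c" and new: "new = [(p, length v), (r, 2 * length v), (t, 2 * length v)]"
    "distinct new" "set new \<inter> N = {}"
    and wf: "wf_prog N (Program v ini nx J)" and atoms: "\<And>d. d \<in> set_pfm \<psi> \<Longrightarrow> over N (set v \<times> {0}) d"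
    and I: "interpretation_of_preds I" and models: "models (hold T I) M (Quant QAf \<psi>)"
    and wfR: "\<And>Q. (\<And>s. Q s \<Longrightarrow> \<not> has_fair_path M s) \<Longrightarrow> wf {(s', s). Q s \<and> R s s'}"
    and body: "\<And>L \<sigma>. agree N L I \<Longrightarrow> L (t, 2 * length v) = ext2 T v (step M)\<^sup>+\<^sup>+ \<Longrightarrow> in_range T \<sigma> \<Longrightarrow>
      eval T L \<sigma> body \<Longrightarrow> R (slice v \<sigma> 0) (slice v \<sigma> k)"
  shows "extends_to T N (N \<union> set new) I
    {Imp (Conj ini (Neg c)) (app p v [0]), Imp (Conj nx (app p v [0])) (app p v [1]),
     Imp (Conj (app p v [0]) body) (app r v [0, k]), Dwf (r, 2 * length v),
     Imp nx (app t v [0, 1]), Imp (Conj (app t v [0, 1]) (shift 1 nx)) (app t v [0, 2])}"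
proof -
  have over: "over N (set v \<times> {0}) ini" "over N (set v \<times> {0, 1}) nx" "over N (set v \<times> {0}) c"
    using wf p_assn_over[OF psi] atoms by auto
  define Q where "Q s \<longleftrightarrow> (\<exists>s0\<in>inits M. \<not> hold T I c s0 \<and> (step M)\<^sup>*\<^sup>* s0 s)" for s
  \<comment> \<open>A fair path from a reached state extends backwards to one from
    \<open>s0\<close>. Then \<open>models\<close> makes \<open>c\<close> true at its first state,
    which is \<open>s0\<close>.\<close>
  have Q: "\<not> has_fair_path M s" if "Q s" for s
  proof
    assume "has_fair_path M s"
    with that obtain s0 where s0: "s0 \<in> inits M" "\<not> hold T I c s0" "has_fair_path M s0"
      by (auto simp: Q_def dest: has_fair_path_back)
    then obtain \<pi> where \<pi>: "\<pi> \<in> fair_paths M s0" by (auto simp: has_fair_path_def)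
    with models s0(1) have "psat (hold T I) M \<psi> \<pi>" by (simp add: models_def)
    moreover have "\<pi> 0 = s0" using \<pi> by (simp add: fair_paths_def paths_def)
    ultimately show False using s0(2) p_assn_sat[OF psi, of T I M \<pi>] by simp
  qed
  \<comment> \<open>On states with fair paths \<open>R\<close> may admit infinite chains; the
    conjunct \<open>Q s\<close> is available because the clause for \<open>r\<close> has
    \<open>p\<close> in its body.\<close>
  let ?R = "\<lambda>s s'. Q s \<and> R s s'"
  define K where "K = I((p, length v) := ext1 T v Q, (r, 2 * length v) := ext2 T v ?R,
    (t, 2 * length v) := ext2 T v (step M)\<^sup>+\<^sup>+)"
  have "interpretation_of_preds K"
    unfolding K_def by (intro interp_update I) (auto dest: length_ext1 length_ext2)
  moreover have "agree N K I" using new(3) by (auto simp: agree_def K_def new(1))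
  moreover have "sat_clause T L d"
    if L: "agree (N \<union> set new) L K" and d: "d \<in> {Imp (Conj ini (Neg c)) (app p v [0]),
       Imp (Conj nx (app p v [0])) (app p v [1]),
       Imp (Conj (app p v [0]) body) (app r v [0, k]), Dwf (r, 2 * length v),
       Imp nx (app t v [0, 1]), Imp (Conj (app t v [0, 1]) (shift 1 nx)) (app t v [0, 2])}" for L d
  proof -
    have LI: "agree N L I"
      using L \<open>agree N K I\<close> by (auto simp: agree_def)
    have Lp: "L (p, length v) = ext1 T v Q" and Lr: "L (r, 2 * length v) = ext2 T v ?R"
      and Lt: "L (t, 2 * length v) = ext2 T v (step M)\<^sup>+\<^sup>+"
      using L new(2) by (auto simp: agree_def new(1) K_def)
    note app = eval_app1[where I = L and p = p, OF Lp] eval_app2[where I = L and p = r, OF Lr]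
      eval_app2[where I = L and p = t, OF Lt]
    have nx: "step M (slice v \<sigma> 0) (slice v \<sigma> 1)" if "in_range T \<sigma>" "eval T L \<sigma> nx" for \<sigma>
      using that eval_slice2[OF over(2) LI] states_slice[OF that(1)] by (simp add: M_def)
    have 1: "sat_clause T L (Imp (Conj ini (Neg c)) (app p v [0]))"
      unfolding sat_Imp
    proof (intro allI impI)
      fix \<sigma> assume \<sigma>: "in_range T \<sigma>" "eval T L \<sigma> (Conj ini (Neg c))"
      then have "slice v \<sigma> 0 \<in> inits M" "\<not> hold T I c (slice v \<sigma> 0)"
        using eval_slice[OF over(1) LI, of T \<sigma>] eval_slice[OF over(3) LI, of T \<sigma>]
        by (simp_all add: M_def states_slice)
      then show "eval T L \<sigma> (app p v [0])" using app(1)[OF \<sigma>(1)] by (auto simp: Q_def)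
    qed
    have 2: "sat_clause T L (Imp (Conj nx (app p v [0])) (app p v [1]))"
      unfolding sat_Imp using nx by (auto simp: app Q_def intro: rtranclp.rtrancl_into_rtrancl)
    have 3: "sat_clause T L (Imp (Conj (app p v [0]) body) (app r v [0, k]))"
      unfolding sat_Imp using body[OF LI Lt] by (simp add: app)
    have "wf {(s', s). s \<in> states T v \<and> s' \<in> states T v \<and> ?R s s'}"
      by (rule wf_subset[OF wfR[of Q]]) (auto dest: Q)
    then have 4: "sat_clause T L (Dwf (r, 2 * length v))" by (rule sat_Dwf[where I = L and R = ?R, OF Lr])
    have 5: "sat_clause T L (Imp nx (app t v [0, 1]))"
      unfolding sat_Imp using nx by (auto simp: app)
    have "step M (slice v \<sigma> 1) (slice v \<sigma> 2)" if "in_range T \<sigma>" "eval T L \<sigma> (shift 1 nx)" for \<sigma>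
      using that eval_slice2_shift[OF over(2) LI, of T \<sigma> 1] states_slice[OF that(1)]
      by (simp add: M_def numeral_2_eq_2)
    then have 6: "sat_clause T L (Imp (Conj (app t v [0, 1]) (shift 1 nx)) (app t v [0, 2]))"
      unfolding sat_Imp by (auto simp: app intro: tranclp.trancl_into_trancl)
    show ?thesis using d 1 2 3 4 5 6 by blast
  qed
  ultimately show ?thesis unfolding extends_to_def by blast
qed

lemma Af_fair_clauses:
  fixes I :: "'p pred \<Rightarrow> 'e list set" and ini :: "('f, 'r, 'p, 'x, 'e) fm"
  assumes psi: "p_assn \<psi> c" "J \<noteq> []" "k = length J"
    and new: "new = [(p, length v), (r, 2 * length v), (t, 2 * length v)]"
    "distinct new" "set new \<inter> N = {}"
    and wf: "wf_prog N (Program v ini nx J)" and atoms: "\<And>d. d \<in> set_pfm \<psi> \<Longrightarrow> over N (set v \<times> {0}) d"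
    and I: "interpretation_of_preds I"
    and models: "models (hold T I) (sem T I (Program v ini nx J)) (Quant QAf \<psi>)"
  shows "extends_to T N (N \<union> set new) I
    {Imp (Conj ini (Neg c)) (app p v [0]), Imp (Conj nx (app p v [0])) (app p v [1]),
     Imp (Conj (app p v [0])
       (conjs (map (\<lambda>i. Conj (app t v [i, i + 1]) (shift (i + 1) (J ! i))) [0..<k])))
       (app r v [0, k]), Dwf (r, 2 * length v),
     Imp nx (app t v [0, 1]), Imp (Conj (app t v [0, 1]) (shift 1 nx)) (app t v [0, 2])}"
proof (rule Af_clauses[OF psi(1) new wf atoms I models])
  let ?M = "sem T I (Program v ini nx J)"
  show "wf {(s', s). Q s \<and> chain_through (step ?M) (fairness ?M) s s'}"
    if "\<And>s. Q s \<Longrightarrow> \<not> has_fair_path ?M s" for Q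
    using wf_chain_through[OF _ that] psi(2) by simp
  fix L \<sigma>
  assume LI: "agree N L I" and Lt: "L (t, 2 * length v) = ext2 T v (step ?M)\<^sup>+\<^sup>+" and \<sigma>: "in_range T \<sigma>"
    and ev: "eval T L \<sigma> (conjs (map (\<lambda>i. Conj (app t v [i, i + 1]) (shift (i + 1) (J ! i))) [0..<k]))"
  have "(step ?M)\<^sup>+\<^sup>+ (slice v \<sigma> i) (slice v \<sigma> (Suc i)) \<and> hold T I (J ! i) (slice v \<sigma> (Suc i))"
    if "i < k" for i
  proof -
    have "over N (set v \<times> {0}) (J ! i)" using wf that psi(3) by simp
    from eval_slice_shift[OF this LI, of T \<sigma> "i + 1"]
    show ?thesis using ev that eval_app2[where I = L and p = t, OF Lt \<sigma>]
      by (auto simp: eval_conjs)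
  qed
  \<comment> \<open>The intermediate points of the chain are the copies of \<open>v\<close> under
    \<open>\<sigma>\<close>.\<close>
  then show "chain_through (step ?M) (fairness ?M) (slice v \<sigma> 0) (slice v \<sigma> k)"
    unfolding chain_through_def using psi(3) by (intro exI[of _ "slice v \<sigma>"]) auto
qed

lemma Af_unfair_clauses:
  fixes I :: "'p pred \<Rightarrow> 'e list set" and ini :: "('f, 'r, 'p, 'x, 'e) fm"
  assumes psi: "p_assn \<psi> c"
    and new: "new = [(p, length v), (r, 2 * length v), (t, 2 * length v)]"
    "distinct new" "set new \<inter> N = {}"
    and wf: "wf_prog N (Program v ini nx [])" and atoms: "\<And>d. d \<in> set_pfm \<psi> \<Longrightarrow> over N (set v \<times> {0}) d"
    and I: "interpretation_of_preds I"
    and models: "models (hold T I) (sem T I (Program v ini nx [])) (Quant QAf \<psi>)"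
  shows "extends_to T N (N \<union> set new) I
    {Imp (Conj ini (Neg c)) (app p v [0]), Imp (Conj nx (app p v [0])) (app p v [1]),
     Imp (Conj (app p v [0]) (app t v [0, 1])) (app r v [0, 1]), Dwf (r, 2 * length v),
     Imp nx (app t v [0, 1]), Imp (Conj (app t v [0, 1]) (shift 1 nx)) (app t v [0, 2])}"
proof (rule Af_clauses[OF psi(1) new wf atoms I models])
  let ?M = "sem T I (Program v ini nx [])"
  show "wf {(s', s). Q s \<and> (step ?M)\<^sup>+\<^sup>+ s s'}" if "\<And>s. Q s \<Longrightarrow> \<not> has_fair_path ?M s" for Q
    using wf_tranclp_unfair[OF _ that] by simp
  show "(step ?M)\<^sup>+\<^sup>+ (slice v \<sigma> 0) (slice v \<sigma> 1)"
    if "L (t, 2 * length v) = ext2 T v (step ?M)\<^sup>+\<^sup>+" "in_range T \<sigma>" "eval T L \<sigma> (app t v [0, 1])" for L \<sigma>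
    using that(3) eval_app2[where I = L and p = t, OF that(1,2)] by blast
qed

lemma Ef_models:
  assumes "p_assn \<psi> c" "models (hold T I) M (Quant QEf \<psi>)" "s \<in> inits M"
  shows "hold T I c s" "has_fair_path M s"
  using assms by (auto simp: models_def has_fair_path_def fair_paths_def paths_def p_assn_sat)

text \<open>Since all \<open>q ! i\<close> have the same meaning, meeting \<open>J ! i\<close>
  allows any successor with a fair path to continue with the next index; otherwise the step must
  lower the rank for \<open>J ! i\<close>. Transitivity of \<open>r ! i\<close> is that of the order
  on ranks.\<close>

lemma Ef_fair_clauses:
  fixes T :: "('f, 'r, 'x, 'e) background" and I :: "'p pred \<Rightarrow> 'e list set"
    and v :: "'x list" and ini nx :: "('f, 'r, 'p, 'x, 'e) fm" and J :: "('f, 'r, 'p, 'x, 'e) fm list"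
  defines "M \<equiv> sem T I (Program v ini nx J)"
  assumes psi: "p_assn \<psi> c" and k: "J \<noteq> []" "k = length J" "length q = k" "length r = k"
    and new: "new = map (\<lambda>a. (a, length v)) q @ map (\<lambda>a. (a, 2 * length v)) r"
    "distinct new" "set new \<inter> N = {}"
    and wf: "wf_prog N (Program v ini nx J)" and atoms: "\<And>d. d \<in> set_pfm \<psi> \<Longrightarrow> over N (set v \<times> {0}) d"
    and I: "interpretation_of_preds I" and models: "models (hold T I) M (Quant QEf \<psi>)"
  shows "extends_to T N (N \<union> set new) I
    ({Imp ini (Conj c (app (q ! 0) v [0]))} \<union>
     (\<Union>i<k.
       {Imp (app (q ! i) v [0])
          (exs v 1 (Conj nx
            (Disj (Conj (J ! i) (app (q ! ((i + 1) mod k)) v [1]))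
                  (Conj (app (r ! i) v [0, 1]) (app (q ! i) v [1]))))),
        Dwf (r ! i, 2 * length v),
        Imp (Conj (app (r ! i) v [0, 1]) (app (r ! i) v [1, 2])) (app (r ! i) v [0, 2])}))"
proof -
  have over: "over N (set v \<times> {0}) ini" "over N (set v \<times> {0, 1}) nx" "over N (set v \<times> {0}) c"
    using wf p_assn_over[OF psi] atoms by auto
  define R where "R i s s' \<longleftrightarrow> fair_rank M (hold T I (J ! i)) s' < fair_rank M (hold T I (J ! i)) s" for i s s'
  define K where "K = (\<lambda>pr. if \<exists>i<k. pr = (q ! i, length v) then ext1 T v (has_fair_path M)
    else if \<exists>i<k. pr = (r ! i, 2 * length v)
    then (\<Union>i\<in>{i. i < k \<and> pr = (r ! i, 2 * length v)}. ext2 T v (R i)) else I pr)"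
  \<comment> \<open>For empty \<open>v\<close> the arities \<open>length v\<close> and
    \<open>2 * length v\<close> coincide, so the separation rests on distinctness of
    \<open>new\<close>.\<close>
  have qr: "(q ! i, length v) \<noteq> (r ! j, 2 * length v)" if "i < k" "j < k" for i j
  proof -
    have "(q ! i, length v) \<in> (\<lambda>a. (a, length v)) ` set q" "(r ! j, 2 * length v) \<in> (\<lambda>a. (a, 2 * length v)) ` set r"
      using that k by simp_all
    then show ?thesis using new(2) unfolding new(1) by fastforce
  qed
  have dr: "r ! i = r ! j \<longleftrightarrow> i = j" if "i < k" "j < k" for i j
    using new(2) that k(4) by (simp add: new(1) distinct_map nth_eq_iff_index_eq)
  have new_iff: "pr \<in> set new \<longleftrightarrow> (\<exists>i<k. pr = (q ! i, length v)) \<or> (\<exists>i<k. pr = (r ! i, 2 * length v))" for pr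
  proof -
    have "set q = {q ! i | i. i < k}" "set r = {r ! i | i. i < k}"
      using k by (simp_all add: set_conv_nth)
    then show ?thesis by (auto simp: new(1))
  qed
  have Kq: "K (q ! i, length v) = ext1 T v (has_fair_path M)" if "i < k" for i
    using that by (auto simp: K_def)
  have Kr: "K (r ! i, 2 * length v) = ext2 T v (R i)" if "i < k" for i
  proof -
    have "{j. j < k \<and> (r ! i, 2 * length v) = (r ! j, 2 * length v)} = {i}" using dr that by auto
    moreover have "\<not> (\<exists>j<k. (r ! i, 2 * length v) = (q ! j, length v))" using qr that by metis
    ultimately show ?thesis using that by (auto simp: K_def)
  qed
  have "interpretation_of_preds K"
    using I by (auto simp: interpretation_of_preds_def K_def dest: length_ext1 length_ext2)
  moreover have "agree N K I"
  proof -
    have "K pr = I pr" if "pr \<notin> set new" for pr using that unfolding new_iff K_def by (metis (no_types, lifting))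
    then show ?thesis using new(3) by (auto simp: agree_def)
  qed
  moreover have "sat_clause T L d"
    if L: "agree (N \<union> set new) L K" and d: "d \<in> {Imp ini (Conj c (app (q ! 0) v [0]))} \<union>
     (\<Union>i<k.
       {Imp (app (q ! i) v [0])
          (exs v 1 (Conj nx
            (Disj (Conj (J ! i) (app (q ! ((i + 1) mod k)) v [1]))
                  (Conj (app (r ! i) v [0, 1]) (app (q ! i) v [1]))))),
        Dwf (r ! i, 2 * length v),
        Imp (Conj (app (r ! i) v [0, 1]) (app (r ! i) v [1, 2])) (app (r ! i) v [0, 2])})" for L d
  proof -
    have LI: "agree N L I" using L \<open>agree N K I\<close> by (auto simp: agree_def)
    have Lq: "L (q ! i, length v) = ext1 T v (has_fair_path M)"
      and Lr: "L (r ! i, 2 * length v) = ext2 T v (R i)" if "i < k" for i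
    proof -
      have "(q ! i, length v) \<in> set new" "(r ! i, 2 * length v) \<in> set new"
        unfolding new_iff using that by blast+
      then show "L (q ! i, length v) = ext1 T v (has_fair_path M)" "L (r ! i, 2 * length v) = ext2 T v (R i)"
        using L Kq[OF that] Kr[OF that] by (simp_all add: agree_def)
    qed
    have 1: "sat_clause T L (Imp ini (Conj c (app (q ! 0) v [0])))"
      unfolding sat_Imp
      using eval_slice[OF over(1) LI] eval_slice[OF over(3) LI] k Ef_models[OF psi models]
        eval_app1[where I = L, OF Lq[of 0]] by (auto simp: M_def states_slice)
    have 2: "sat_clause T L (Imp (app (q ! i) v [0])
          (exs v 1 (Conj nx
            (Disj (Conj (J ! i) (app (q ! ((i + 1) mod k)) v [1]))
                  (Conj (app (r ! i) v [0, 1]) (app (q ! i) v [1]))))))" if i: "i < k" for i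
      unfolding sat_Imp
    proof (intro allI impI)
      fix \<sigma> assume \<sigma>: "in_range T \<sigma>" and "eval T L \<sigma> (app (q ! i) v [0])"
      then have fp: "has_fair_path M (slice v \<sigma> 0)" using eval_app1[where I = L, OF Lq[OF i]] by blast
      have j: "(i + 1) mod k < k" using i by simp
      have J: "over N (set v \<times> {0}) (J ! i)" using wf i k by simp
      have "hold T I (J ! i) \<in> set (fairness M)" using i k by (simp add: M_def)
      then obtain s' where s': "step M (slice v \<sigma> 0) s'" "has_fair_path M s'"
        "hold T I (J ! i) (slice v \<sigma> 0) \<or> R i (slice v \<sigma> 0) s'"
        using fair_step[OF fp] fair_rank_step[OF fp] unfolding R_def by blast
      show "eval T L \<sigma> (exs v 1 (Conj nx
            (Disj (Conj (J ! i) (app (q ! ((i + 1) mod k)) v [1]))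
                  (Conj (app (r ! i) v [0, 1]) (app (q ! i) v [1])))))"
        using s' \<sigma> eval_slice2[OF over(2) LI] eval_slice[OF J LI]
          eval_app1[where I = L, OF Lq[OF i]] eval_app1[where I = L, OF Lq[OF j]]
          eval_app2[where I = L, OF Lr[OF i]]
        by (intro slice_next[of T \<sigma> s']) (auto simp: M_def)
    qed
    have 3: "sat_clause T L (Dwf (r ! i, 2 * length v))" if i: "i < k" for i
    proof (rule sat_Dwf[where R = "R i"])
      show "L (r ! i, 2 * length v) = ext2 T v (R i)" using Lr[OF i] .
      show "wf {(s', s). s \<in> states T v \<and> s' \<in> states T v \<and> R i s s'}"
        by (rule wf_subset[OF wf_measure[of "fair_rank M (hold T I (J ! i))"]]) (auto simp: R_def)
    qed
    have 4: "sat_clause T L (Imp (Conj (app (r ! i) v [0, 1]) (app (r ! i) v [1, 2])) (app (r ! i) v [0, 2]))"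
      if i: "i < k" for i
      unfolding sat_Imp using eval_app2[where I = L, OF Lr[OF i]] by (auto simp: R_def)
    show ?thesis using d 1 2 3 4 by blast
  qed
  ultimately show ?thesis unfolding extends_to_def by blast
qed

lemma Ef_unfair_clauses:
  fixes T :: "('f, 'r, 'x, 'e) background" and I :: "'p pred \<Rightarrow> 'e list set"
    and v :: "'x list" and ini nx :: "('f, 'r, 'p, 'x, 'e) fm" and J :: "('f, 'r, 'p, 'x, 'e) fm list"
  defines "M \<equiv> sem T I (Program v ini nx [])"
  assumes psi: "p_assn \<psi> c" and new: "(q, length v) \<notin> N"
    and wf: "wf_prog N (Program v ini nx [])" and atoms: "\<And>d. d \<in> set_pfm \<psi> \<Longrightarrow> over N (set v \<times> {0}) d"
    and I: "interpretation_of_preds I" and models: "models (hold T I) M (Quant QEf \<psi>)"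
  shows "extends_to T N (insert (q, length v) N) I
    {Imp ini (Conj c (app q v [0])), Imp (app q v [0]) (exs v 1 (Conj nx (app q v [1])))}"
proof -
  have over: "over N (set v \<times> {0}) ini" "over N (set v \<times> {0, 1}) nx" "over N (set v \<times> {0}) c"
    using wf p_assn_over[OF psi] atoms by auto
  define K where "K = I((q, length v) := ext1 T v (has_fair_path M))"
  have "interpretation_of_preds K"
    unfolding K_def by (intro interp_update I) (auto dest: length_ext1)
  moreover have "agree N K I" using new by (auto simp: agree_def K_def)
  moreover have "sat_clause T L d"
    if L: "agree (insert (q, length v) N) L K" and d: "d \<in> {Imp ini (Conj c (app q v [0])),
      Imp (app q v [0]) (exs v 1 (Conj nx (app q v [1])))}" for L d
  proof -
    have LI: "agree N L I" using L \<open>agree N K I\<close> by (auto simp: agree_def)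
    have "L (q, length v) = ext1 T v (has_fair_path M)" using L by (simp add: agree_def K_def)
    note app = eval_app1[where I = L, OF this]
    have 1: "sat_clause T L (Imp ini (Conj c (app q v [0])))"
      unfolding sat_Imp
      using eval_slice[OF over(1) LI] eval_slice[OF over(3) LI] Ef_models[OF psi models]
      by (auto simp: app M_def states_slice)
    have 2: "sat_clause T L (Imp (app q v [0]) (exs v 1 (Conj nx (app q v [1]))))"
      unfolding sat_Imp
    proof (intro allI impI)
      fix \<sigma> assume \<sigma>: "in_range T \<sigma>" and "eval T L \<sigma> (app q v [0])"
      then have "has_fair_path M (slice v \<sigma> 0)" by (simp add: app)
      from fair_step[OF this] obtain s' where s': "step M (slice v \<sigma> 0) s'" "has_fair_path M s'"
        by (elim exE conjE)
      show "eval T L \<sigma> (exs v 1 (Conj nx (app q v [1])))"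
        using s' \<sigma> eval_slice2[OF over(2) LI]
        by (intro slice_next[of T \<sigma> s']) (simp_all add: M_def app)
    qed
    show ?thesis using d 1 2 by auto
  qed
  ultimately show ?thesis unfolding extends_to_def by blast
qed

lemma assn_clause:
  fixes I :: "'p pred \<Rightarrow> 'e list set" and ini :: "('f, 'r, 'p, 'x, 'e) fm"
  assumes phi: "s_assn \<phi> c"
    and wf: "wf_prog N (Program v ini nx J)" and atoms: "\<And>d. d \<in> set_sfm \<phi> \<Longrightarrow> over N (set v \<times> {0}) d"
    and I: "interpretation_of_preds I" and models: "models (hold T I) (sem T I (Program v ini nx J)) \<phi>"
  shows "extends_to T N N I {Imp ini c}"
proof -
  have over: "over N (set v \<times> {0}) ini" "over N (set v \<times> {0}) c"
    using wf s_assn_over[OF phi] atoms by auto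
  have "sat_clause T L (Imp ini c)" if LI: "agree N L I" for L
    unfolding sat_Imp
    using eval_slice[OF over(1) LI] eval_slice[OF over(2) LI] models
    by (simp add: models_def s_assn_sat[OF phi] states_slice)
  then show ?thesis unfolding extends_to_def using I by (intro exI[of _ I]) (auto simp: agree_def)
qed

section \<open>Recursive rules and the induction on runs\<close>

lemma translate_mono: "translate T N D \<phi> C N' \<Longrightarrow> N \<subseteq> N'"
  by (induction rule: translate.induct) auto

lemma hold_app:
  assumes "I (p, length v) = ext1 T v Q" "s \<in> states T v"
  shows "hold T I (app p v [0]) s \<longleftrightarrow> Q s"
proof -
  have "map (slice v (\<lambda>(x, n). s x) 0) v = map s v" by (simp add: slice_def)
  then have "concat (map (\<lambda>n. map (slice v (\<lambda>(x, n). s x) n) v) [0]) = map s v" by simp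
  then have "hold T I (app p v [0]) s \<longleftrightarrow> map s v \<in> I (p, length [0 :: nat] * length v)"
    unfolding hold_def eval_app by (simp only:)
  with map_in_ext1[OF assms(2), of Q] assms(1) show ?thesis by simp
qed

lemma over_app: "(p, length v) \<in> N \<Longrightarrow> over N (set v \<times> {0}) (app p v [0])"
  by (simp add: over_def fvars_app preds_app)

text \<open>Setting both initial conditions to \<open>Top\<close> brings the systems within reach of
  \<open>sem_cong\<close>. The actual ones may mention \<open>aux\<close>, on which the two
  interpretations disagree.\<close>

lemma sem_init_cong:
  fixes nx :: "('f, 'r, 'p, 'x, 'e) fm"
  assumes "over N (set v \<times> {0, 1}) nx" "\<And>j. j \<in> set J \<Longrightarrow> over N (set v \<times> {0}) j" "agree N I K"
  shows "step (sem T I (Program v ini nx J)) = step (sem T K (Program v ini' nx J))"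
    and "fairness (sem T I (Program v ini nx J)) = fairness (sem T K (Program v ini' nx J))"
proof -
  have "sem T I (Program v (Top :: ('f, 'r, 'p, 'x, 'e) fm) nx J) = sem T K (Program v Top nx J)"
    using assms by (intro sem_cong[of N]) (auto simp: over_def)
  then show "step (sem T I (Program v ini nx J)) = step (sem T K (Program v ini' nx J))"
    and "fairness (sem T I (Program v ini nx J)) = fairness (sem T K (Program v ini' nx J))"
    by (simp_all add: sem_def)
qed

text \<open>Once \<open>aux\<close> denotes exactly the states satisfying \<open>\<alpha>\<close>,
  the first sub-run has a program that satisfies \<open>\<alpha>\<close> initially, and the
  substitution in the second leaves the truth of \<open>\<phi>\<close> unchanged. The sub-runs
  extend the interpretation one after the other.\<close>

lemma extends_to_basic:
  fixes T :: "('f, 'r, 'x, 'e) background" and I :: "'p pred \<Rightarrow> 'e list set"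
    and \<phi> :: "('f, 'r, 'p, 'x, 'e) fm sfm"
  assumes sub: "\<alpha> \<in> s_subs \<phi>" and fresh: "(aux, length v) \<notin> N" and N1: "insert (aux, length v) N \<subseteq> N\<^sub>1" "N\<^sub>1 \<subseteq> N\<^sub>2"
    and wf: "wf_prog N (Program v ini nx J)" and atoms: "\<And>c. c \<in> set_sfm \<phi> \<Longrightarrow> over N (set v \<times> {0}) c"
    and I: "interpretation_of_preds I" and models: "models (hold T I) (sem T I (Program v ini nx J)) \<phi>"
    and run1: "\<And>K. interpretation_of_preds K \<Longrightarrow>
      models (hold T K) (sem T K (Program v (app aux v [0]) nx J)) \<alpha> \<Longrightarrow>
      extends_to T (insert (aux, length v) N) N\<^sub>1 K C\<^sub>1"
    and run2: "\<And>K. interpretation_of_preds K \<Longrightarrow>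
      models (hold T K) (sem T K (Program v ini nx J)) (s_repl \<alpha> (Asrt (app aux v [0])) \<phi>) \<Longrightarrow>
      extends_to T N\<^sub>1 N\<^sub>2 K C\<^sub>2"
  shows "extends_to T N N\<^sub>2 I (C\<^sub>1 \<union> C\<^sub>2)"
proof -
  let ?M = "sem T I (Program v ini nx J)"
  define Q where "Q s \<longleftrightarrow> ssat (hold T I) ?M \<alpha> s" for s
  define K1 where "K1 = I((aux, length v) := ext1 T v Q)"
  have K1: "interpretation_of_preds K1"
    unfolding K1_def by (intro interp_update I) (auto dest: length_ext1)
  have K1I: "agree N K1 I" using fresh by (auto simp: agree_def K1_def)
  have sub_atoms: "set_sfm \<alpha> \<subseteq> set_sfm \<phi>" by (rule s_subs_atoms(1)[OF sub])
  have val: "hold T K c s = hold T I c s" if "agree N K I" "c \<in> set_sfm \<phi>" for K c s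
    using hold_cong[OF atoms[OF that(2)] that(1)] by blast
  have "models (hold T K1) (sem T K1 (Program v (app aux v [0]) nx J)) \<alpha>"
    unfolding models_def
  proof
    fix s assume s: "s \<in> inits (sem T K1 (Program v (app aux v [0]) nx J))"
    have "K1 (aux, length v) = ext1 T v Q" by (simp add: K1_def)
    from hold_app[of K1, OF this] s have "Q s" by auto
    moreover have "ssat (hold T K1) (sem T K1 (Program v (app aux v [0]) nx J)) \<alpha> s = ssat (hold T I) ?M \<alpha> s"
      using wf val[OF K1I] sub_atoms
      by (intro sat_cong(1) sem_init_cong[of N] K1I) auto
    ultimately show "ssat (hold T K1) (sem T K1 (Program v (app aux v [0]) nx J)) \<alpha> s"
      by (simp add: Q_def)
  qed
  from run1[OF K1 this] obtain K2 where K2: "interpretation_of_preds K2"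
    "agree (insert (aux, length v) N) K2 K1" "\<And>L. agree N\<^sub>1 L K2 \<Longrightarrow> \<forall>c\<in>C\<^sub>1. sat_clause T L c"
    unfolding extends_to_def by blast
  have K2I: "agree N K2 I" using K2(2) K1I by (auto simp: agree_def)
  have MK2: "sem T K2 (Program v ini nx J) = ?M" by (rule sem_cong[OF wf K2I])
  have "models (hold T K2) ?M (s_repl \<alpha> (Asrt (app aux v [0])) \<phi>)"
    unfolding models_def
  proof
    fix s assume s: "s \<in> inits ?M"
    have aux: "K2 (aux, length v) = ext1 T v Q" using K2(2) by (simp add: agree_def K1_def)
    have "ssat (hold T K2) ?M (Asrt (app aux v [0])) s' = ssat (hold T K2) ?M \<alpha> s'"
      if "s' \<in> states T v" for s'
    proof -
      have "ssat (hold T K2) ?M \<alpha> s' = ssat (hold T I) ?M \<alpha> s'"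
        using val[OF K2I] sub_atoms by (intro sat_cong(1)) auto
      then show ?thesis using hold_app[of K2, OF aux that] by (simp add: Q_def)
    qed
    then have "ssat (hold T K2) ?M (s_repl \<alpha> (Asrt (app aux v [0])) \<phi>) s = ssat (hold T K2) ?M \<phi> s"
      using s by (intro sat_repl(1)[where S = "states T v"]) simp_all
    also have "\<dots> = ssat (hold T I) ?M \<phi> s"
      using val[OF K2I] by (intro sat_cong(1)) auto
    finally show "ssat (hold T K2) ?M (s_repl \<alpha> (Asrt (app aux v [0])) \<phi>) s"
      using models s by (simp add: models_def)
  qed
  with MK2 run2[OF K2(1)] have "extends_to T N\<^sub>1 N\<^sub>2 K2 C\<^sub>2" by metis
  then obtain K3 where K3: "interpretation_of_preds K3" "agree N\<^sub>1 K3 K2"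
    "\<And>L. agree N\<^sub>2 L K3 \<Longrightarrow> \<forall>c\<in>C\<^sub>2. sat_clause T L c"
    unfolding extends_to_def by blast
  have "agree N K3 I" using K3(2) K2I N1 by (auto simp: agree_def)
  \<comment> \<open>The clauses of the first sub-run survive the second, which only interprets
    symbols outside \<open>N\<^sub>1\<close>.\<close>
  moreover have "agree N\<^sub>1 L K2" if "agree N\<^sub>2 L K3" for L
    using K3(2) that N1(2) by (auto simp: agree_def)
  ultimately show ?thesis unfolding extends_to_def using K3(1,3) K2(3) by (intro exI[of _ K3]) blast
qed

text \<open>An empty fairness list makes every path fair, and inside \<open>\<psi>\<close> no
  quantifier notices the change.\<close>

lemma models_all_paths:
  assumes "p_qfree \<psi>"
  shows "models (hold T I) (sem T I (Program v ini nx J)) (Quant QA \<psi>) \<longleftrightarrow>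
      models (hold T I) (sem T I (Program v ini nx [])) (Quant QAf \<psi>)"
    and "models (hold T I) (sem T I (Program v ini nx J)) (Quant QE \<psi>) \<longleftrightarrow>
      models (hold T I) (sem T I (Program v ini nx [])) (Quant QEf \<psi>)"
proof -
  have "fair_paths (sem T I (Program v ini nx [])) s = paths (sem T I (Program v ini nx J)) s" for s
    by (auto simp: fair_paths_def paths_def)
  moreover have "psat (hold T I) (sem T I (Program v ini nx [])) \<psi> \<pi> =
      psat (hold T I) (sem T I (Program v ini nx J)) \<psi> \<pi>" for \<pi>
    using assms by (intro qfree_sat_cong(2)) auto
  ultimately show "models (hold T I) (sem T I (Program v ini nx J)) (Quant QA \<psi>) \<longleftrightarrow>
      models (hold T I) (sem T I (Program v ini nx [])) (Quant QAf \<psi>)"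
    and "models (hold T I) (sem T I (Program v ini nx J)) (Quant QE \<psi>) \<longleftrightarrow>
      models (hold T I) (sem T I (Program v ini nx [])) (Quant QEf \<psi>)"
    by (auto simp: models_def)
qed

context monitored
begin

lemma models_Af_monitored:
  assumes "ini' = ini" "models (hold T I) M (Quant QAf \<psi>)"
  shows "models (hold T I) M' (Quant QAf \<psi>')"
  unfolding models_def
proof
  fix s assume s: "s \<in> inits M'"
  have "hold T I ini (proj s) = hold T I ini s" using wf by (intro hold_proj) simp
  with s assms(1) have p: "proj s \<in> inits M" using states_proj by simp
  have "psat (hold T I) M' \<psi>' \<pi>" if \<pi>: "\<pi> \<in> fair_paths M' s" for \<pi>
  proof -
    have 0: "\<pi> 0 = s" using \<pi> by (simp add: fair_paths_def paths_def)
    then have "\<pi> \<in> fair_paths M' (\<pi> 0)" using \<pi> by simp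
    moreover from this have "(\<lambda>i. proj (\<pi> i)) \<in> fair_paths M (proj s)"
      using fair_paths_iff[of \<pi>] 0 by simp
    ultimately show ?thesis using psat_monitored p assms(2) by (simp add: models_def)
  qed
  then show "ssat (hold T I) M' (Quant QAf \<psi>') s" by simp
qed

text \<open>A wrong initial value of \<open>x\<close> admits no fair path, so \<open>aux\<close> has
  to select the extended states that start a witness. The clause leading into \<open>aux\<close>
  then asks for a right value, which the lifted witness of the original program supplies.\<close>

lemma extends_to_Ef_monitored:
  assumes ini': "ini' = app aux (v @ [x]) [0]" and aux: "(aux, length v + 1) \<notin> N"
    and N': "insert (aux, length v + 1) N \<subseteq> N'"
    and I: "interpretation_of_preds I" and models: "models (hold T I) M (Quant QEf \<psi>)"
    and run: "\<And>K. interpretation_of_preds K \<Longrightarrow>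
      models (hold T K) (sem T K (Program (v @ [x]) ini' (Conj nx \<delta>) (J @ js))) (Quant QEf \<psi>') \<Longrightarrow>
      extends_to T (insert (aux, length v + 1) N) N' K C"
  shows "extends_to T N N' I (insert (Imp ini (FEx (x, 0) (app aux (v @ [x]) [0]))) C)"
proof -
  let ?v = "v @ [x]"
  \<comment> \<open>No circularity: \<open>M'\<close> reads \<open>aux\<close> under
    \<open>I\<close>, but only in its initial condition, on which fair paths do not depend.\<close>
  define Q where "Q s \<longleftrightarrow> (\<exists>\<pi>\<in>fair_paths M' s. psat (hold T I) M' \<psi>' \<pi>)" for s
  define K1 where "K1 = I((aux, length ?v) := ext1 T ?v Q)"
  have K1: "interpretation_of_preds K1"
    unfolding K1_def by (intro interp_update I) (auto dest: length_ext1)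
  have K1I: "agree N K1 I" using aux by (auto simp: agree_def K1_def)
  let ?M1 = "sem T K1 (Program ?v ini' (Conj nx \<delta>) (J @ js))"
  have wf': "wf_prog N (Program ?v Top (Conj nx \<delta>) (J @ js))"
  proof -
    have "over N (set ?v \<times> {0, 1}) nx" "\<forall>j\<in>set J. over N (set ?v \<times> {0}) j"
      using wf by (auto intro: over_mono)
    with monitor_over[OF mon atoms_sub] show ?thesis by (auto simp: over_def)
  qed
  have M1: "step ?M1 = step M'" "fairness ?M1 = fairness M'"
    using wf' by (intro sem_init_cong[of N] K1I; auto)+
  have "models (hold T K1) ?M1 (Quant QEf \<psi>')"
    unfolding models_def
  proof
    fix s assume s: "s \<in> inits ?M1"
    have "K1 (aux, length ?v) = ext1 T ?v Q" by (simp add: K1_def)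
    from hold_app[of K1, OF this] s have "Q s" by (auto simp: ini')
    then have "ssat (hold T I) M' (Quant QEf \<psi>') s" by (simp add: Q_def)
    moreover have "ssat (hold T K1) ?M1 (Quant QEf \<psi>') s = ssat (hold T I) M' (Quant QEf \<psi>') s"
      using hold_cong[OF atoms_monitored[OF order_refl] K1I] M1 by (intro sat_cong(1)) auto
    ultimately show "ssat (hold T K1) ?M1 (Quant QEf \<psi>') s" by simp
  qed
  from run[OF K1 this] obtain K2 where K2: "interpretation_of_preds K2"
    "agree (insert (aux, length v + 1) N) K2 K1" "\<And>L. agree N' L K2 \<Longrightarrow> \<forall>c\<in>C. sat_clause T L c"
    unfolding extends_to_def by blast
  have K2I: "agree N K2 I" using K2(2) K1I by (auto simp: agree_def)
  have "sat_clause T L (Imp ini (FEx (x, 0) (app aux ?v [0])))" if L: "agree N' L K2" for L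
    unfolding sat_Imp
  proof (intro allI impI)
    fix \<sigma> assume \<sigma>: "in_range T \<sigma>" "eval T L \<sigma> ini"
    have LI: "agree N L I" using L K2I N' by (auto simp: agree_def)
    have Laux: "L (aux, length ?v) = ext1 T ?v Q"
      using L K2(2) N' by (auto simp: agree_def K1_def)
    have S: "slice v \<sigma> 0 \<in> states T v" using states_slice[OF \<sigma>(1)] .
    have "over N (set v \<times> {0}) ini" using wf by simp
    from eval_slice[OF this LI] \<sigma>(2) S have "slice v \<sigma> 0 \<in> inits M" by simp
    with models obtain \<rho> where \<rho>: "\<rho> \<in> fair_paths M (slice v \<sigma> 0)" "psat (hold T I) M \<psi> \<rho>"
      by (auto simp: models_def)
    from lift_fair_path[OF \<rho>(1) S] obtain \<pi> where \<pi>: "\<pi> \<in> fair_paths M' (\<pi> 0)"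
      "\<And>i. proj (\<pi> i) = \<rho> i" "\<And>i. \<pi> i \<in> states T ?v" by blast
    then have Q: "Q (\<pi> 0)" using psat_monitored[OF \<pi>(1)] \<rho>(2) by (auto simp: Q_def)
    \<comment> \<open>The value for the existential quantifier is the one that the lifted path
      carries at position 0.\<close>
    let ?\<tau> = "\<sigma>((x, 0) := \<pi> 0 x)"
    have b: "\<pi> 0 x \<in> rng T x" using \<pi>(3)[of 0] by (auto simp: states_def)
    then have \<tau>: "in_range T ?\<tau>" using \<sigma>(1) by (simp add: in_range_def)
    have "\<rho> 0 = slice v \<sigma> 0" using \<rho>(1) by (simp add: fair_paths_def paths_def)
    with \<pi>(2)[of 0] have "proj (\<pi> 0) = slice v \<sigma> 0" by simp
    then have "\<pi> 0 y = \<sigma> (y, 0)" if "y \<in> set v" for y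
      using that by (auto simp: slice_def fun_eq_iff split: if_splits)
    then have "slice ?v ?\<tau> 0 = \<pi> 0"
      using \<pi>(3)[of 0] fresh by (auto simp: slice_def fun_eq_iff states_def PiE_def extensional_def)
    then have "eval T L ?\<tau> (app aux ?v [0])"
      using eval_app1[where I = L and p = aux and v = ?v, OF Laux \<tau>] Q by simp
    then show "eval T L \<sigma> (FEx (x, 0) (app aux ?v [0]))" using b by auto
  qed
  with K2 K2I show ?thesis unfolding extends_to_def by (intro exI[of _ K2]) auto
qed

end

text \<open>\<open>I\<close> is generalized because sub-runs start from interpretations that earlier
  choices have already extended.\<close>

theorem translate_sound:
  fixes T :: "('f, 'r, 'x, 'e) background" and I :: "'p pred \<Rightarrow> 'e list set"
    and \<phi> :: "('f, 'r, 'p, 'x, 'e) fm sfm"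
  assumes "translate T N D \<phi> C N'" "tt T \<noteq> ff T" "wf_prog N D"
    "\<And>c. c \<in> set_sfm \<phi> \<Longrightarrow> over N (set (vars D) \<times> {0}) c"
    "interpretation_of_preds I" "models (hold T I) (sem T I D) \<phi>"
  shows "extends_to T N N' I C"
  using assms
proof (induction arbitrary: I rule: translate.induct)
  case (trans_basic \<psi> Q \<phi> aux v N nx J C\<^sub>1 N\<^sub>1 ini C\<^sub>2 N\<^sub>2)
  note hyps = trans_basic.hyps
  have N1: "insert (aux, length v) N \<subseteq> N\<^sub>1" "N\<^sub>1 \<subseteq> N\<^sub>2" using translate_mono hyps by blast+
  have wf: "wf_prog N (Program v ini nx J)" by fact
  have atoms: "over N (set v \<times> {0}) c" if "c \<in> set_sfm \<phi>" for c using trans_basic.prems(3)[OF that] by simp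
  show ?case
  proof (rule extends_to_basic[OF hyps(2,3) N1 wf atoms])
    fix K assume K: "interpretation_of_preds K"
      "models (hold T K) (sem T K (Program v (app aux v [0]) nx J)) (Quant Q \<psi>)"
    show "extends_to T (insert (aux, length v) N) N\<^sub>1 K C\<^sub>1"
    proof (rule trans_basic.IH(1)[OF trans_basic.prems(1) _ _ K])
      show "wf_prog (insert (aux, length v) N) (Program v (app aux v [0]) nx J)"
        using wf by (auto simp: over_app intro: over_mono)
      show "over (insert (aux, length v) N) (set (vars (Program v (app aux v [0]) nx J)) \<times> {0}) c"
        if "c \<in> set_sfm (Quant Q \<psi>)" for c
      proof -
        have "c \<in> set_sfm \<phi>" using s_subs_atoms(1)[OF hyps(2)] that by blast
        then show ?thesis by (auto intro: over_mono[OF atoms])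
      qed
    qed
  next
    fix K assume K: "interpretation_of_preds K"
      "models (hold T K) (sem T K (Program v ini nx J)) (s_repl (Quant Q \<psi>) (Asrt (app aux v [0])) \<phi>)"
    show "extends_to T N\<^sub>1 N\<^sub>2 K C\<^sub>2"
    proof (rule trans_basic.IH(2)[OF trans_basic.prems(1) _ _ K])
      show "wf_prog N\<^sub>1 (Program v ini nx J)" using wf N1 by (auto intro: over_mono)
      show "over N\<^sub>1 (set (vars (Program v ini nx J)) \<times> {0}) c"
        if "c \<in> set_sfm (s_repl (Quant Q \<psi>) (Asrt (app aux v [0])) \<phi>)" for c
      proof -
        have "c \<in> set_sfm \<phi> \<or> c = app aux v [0]"
          using s_repl_atoms(1)[of "Quant Q \<psi>" "Asrt (app aux v [0])" \<phi>] that by auto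
        then show ?thesis
        proof
          assume "c \<in> set_sfm \<phi>"
          then show ?thesis using over_mono[OF atoms, of c N\<^sub>1] N1 by simp
        next
          assume "c = app aux v [0]"
          then show ?thesis using over_app[of aux v N\<^sub>1] N1 by simp
        qed
      qed
    qed
  qed (use trans_basic.prems(4,5) in simp_all)
next
  case (trans_A \<psi> N v ini nx C N' J)
  show ?case
    using trans_A.prems models_all_paths(1)[OF trans_A.hyps(1)]
    by (intro trans_A.IH) auto
next
  case (trans_E \<psi> N v ini nx C N' J)
  show ?case
    using trans_E.prems models_all_paths(2)[OF trans_E.hyps(1)]
    by (intro trans_E.IH) auto
next
  case (trans_Af_temporal \<psi> \<chi> x \<delta> js v N ini nx J C N')
  interpret monitored T N I v ini ini nx \<delta> J js x \<psi> \<chi>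
    using trans_Af_temporal by unfold_locales auto
  have "over N (set (v @ [x]) \<times> {0}) ini" using wf by (auto intro: over_mono)
  then show ?case
    using wf_monitored atoms_monitored models_Af_monitored trans_Af_temporal.prems
    by (intro trans_Af_temporal.IH) auto
next
  case (trans_Ef_temporal \<psi> \<chi> x \<delta> js v aux N nx J C N' ini)
  let ?ini' = "app aux (v @ [x]) [0]"
  interpret monitored T N I v ini ?ini' nx \<delta> J js x \<psi> \<chi>
    using trans_Ef_temporal by unfold_locales auto
  let ?N = "insert (aux, length v + 1) N"
  have "over ?N (set (v @ [x]) \<times> {0}) ?ini'" by (intro over_app) simp
  then have wf': "wf_prog ?N (Program (v @ [x]) ?ini' (Conj nx \<delta>) (J @ js))"
    by (intro wf_monitored) auto
  have atoms': "over ?N (set (v @ [x]) \<times> {0}) c" if "c \<in> set_pfm \<psi>'" for c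
    using atoms_monitored[OF _ that] by auto
  have N': "?N \<subseteq> N'" using translate_mono trans_Ef_temporal.hyps by blast
  show ?case
  proof (rule extends_to_Ef_monitored[OF refl _ N'])
    show "(aux, length v + 1) \<notin> N" by fact
    show "interpretation_of_preds I" by fact
    show "models (hold T I) M (Quant QEf \<psi>)" by fact
    fix K assume "interpretation_of_preds K"
      "models (hold T K) (sem T K (Program (v @ [x]) ?ini' (Conj nx \<delta>) (J @ js))) (Quant QEf \<psi>')"
    then show "extends_to T ?N N' K C"
      using trans_Ef_temporal.prems(1) wf' atoms' by (intro trans_Ef_temporal.IH) auto
  qed
next
  case (trans_Af_fair \<psi> c J k new p v r t N ini nx)
  have "over N (set v \<times> {0}) d" if "d \<in> set_pfm \<psi>" for d using trans_Af_fair.prems(3) that by simp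
  then show ?case
    by (intro Af_fair_clauses[OF trans_Af_fair.hyps trans_Af_fair.prems(2) _ trans_Af_fair.prems(4,5)])
next
  case (trans_Af_unfair \<psi> c new p v r t N ini nx)
  have "over N (set v \<times> {0}) d" if "d \<in> set_pfm \<psi>" for d using trans_Af_unfair.prems(3) that by simp
  then show ?case
    by (intro Af_unfair_clauses[OF trans_Af_unfair.hyps trans_Af_unfair.prems(2) _ trans_Af_unfair.prems(4,5)])
next
  case (trans_Ef_fair \<psi> c J k q r new v N ini nx)
  have "over N (set v \<times> {0}) d" if "d \<in> set_pfm \<psi>" for d using trans_Ef_fair.prems(3) that by simp
  then show ?case
    by (intro Ef_fair_clauses[OF trans_Ef_fair.hyps trans_Ef_fair.prems(2) _ trans_Ef_fair.prems(4,5)])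
next
  case (trans_Ef_unfair \<psi> c q v N ini nx)
  have "over N (set v \<times> {0}) d" if "d \<in> set_pfm \<psi>" for d using trans_Ef_unfair.prems(3) that by simp
  then show ?case
    by (intro Ef_unfair_clauses[OF trans_Ef_unfair.hyps trans_Ef_unfair.prems(2) _ trans_Ef_unfair.prems(4,5)])
next
  case (trans_assn \<phi> c N v ini nx J)
  have "over N (set v \<times> {0}) d" if "d \<in> set_sfm \<phi>" for d using trans_assn.prems(3) that by simp
  then show ?case
    by (intro assn_clause[OF trans_assn.hyps trans_assn.prems(2) _ trans_assn.prems(4,5)])
qed

section \<open>Synthesis\<close>

definition hole_rel :: "('e hole \<Rightarrow> 'e list set) \<Rightarrow> ('e hole \<Rightarrow> ('e list \<times> 'e list) set) \<Rightarrow>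
    'e hole \<Rightarrow> 'e list set" where
  "hole_rel \<Psi>c \<Psi>a h = (case h of Cond l lt lf \<Rightarrow> \<Psi>c h | Assign l l' \<Rightarrow> {as @ bs | as bs. (as, bs) \<in> \<Psi>a h})"

text \<open>If \<open>f\<close> is injective on \<open>H\<close>, exactly one hole contributes to
  the union at a hole predicate; every other predicate gets the empty set.\<close>

definition hole_interp :: "('e hole \<Rightarrow> 'p pred) \<Rightarrow> 'e hole set \<Rightarrow> ('e hole \<Rightarrow> 'e list set) \<Rightarrow>
    'p pred \<Rightarrow> 'e list set" where
  "hole_interp f H R p = (\<Union>h\<in>{h \<in> H. f h = p}. R h)"

lemma hole_interp: "inj_on f H \<Longrightarrow> h \<in> H \<Longrightarrow> hole_interp f H R (f h) = R h"
  unfolding hole_interp_def by (auto dest: inj_onD)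

lemma tuples_length: "as \<in> tuples T v \<Longrightarrow> length as = length v"
  by (auto simp: tuples_def dest: list_all2_lengthD)

lemma map_states_tuples: "s \<in> states T v \<Longrightarrow> map s v \<in> tuples T v"
  by (auto simp: states_def tuples_def list_all2_conv_all_nth)

text \<open>Distinctness is essential, since a tuple could assign two values to a repeated
  variable.\<close>

lemma tuples_map_states:
  assumes "distinct v" "as \<in> tuples T v"
  obtains s where "s \<in> states T v" "map s v = as"
proof -
  define s where "s = restrict (\<lambda>x. the (map_of (zip v as) x)) (set v)"
  have rng: "as ! i \<in> rng T (v ! i)" if "i < length v" for i
    using assms(2) that by (auto simp: tuples_def list_all2_conv_all_nth)
  have len: "length v = length as" using tuples_length[OF assms(2)] by simp
  have s: "s (v ! i) = as ! i" if "i < length v" for i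
    using that map_of_zip_nth[OF len assms(1)] len by (simp add: s_def)
  have "s \<in> states T v"
    unfolding states_def using s rng by (auto simp: in_set_conv_nth) (auto simp: s_def in_set_conv_nth)
  moreover have "map s v = as" using s len by (intro nth_equalityI) auto
  ultimately show thesis using that by blast
qed

lemma hold2_hole:
  fixes \<Psi>c :: "'e hole \<Rightarrow> 'e list set" and s s' :: "'x \<Rightarrow> 'e" and I :: "'p pred \<Rightarrow> 'e list set"
  defines "\<sigma> \<equiv> \<lambda>(x, n :: nat). if n = 0 then s x else s' x"
  shows "eval T I \<sigma> (app p v [0]) \<longleftrightarrow> map s v \<in> I (p, length v)"
    and "eval T I \<sigma> (app p v [0, 1]) \<longleftrightarrow> map s v @ map s' v \<in> I (p, 2 * length v)"
    and "eval T I \<sigma> (conjs (map (\<lambda>x. Eq (Var (x, 1)) (Var (x, 0))) v)) \<longleftrightarrow> map s' v = map s v"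
proof -
  have "map (slice v \<sigma> 0) v = map s v" "map (slice v \<sigma> 1) v = map s' v"
    by (auto simp: slice_def \<sigma>_def)
  then have "concat (map (\<lambda>n. map (slice v \<sigma> n) v) [0]) = map s v"
      "concat (map (\<lambda>n. map (slice v \<sigma> n) v) [0, 1]) = map s v @ map s' v"
    by (simp_all del: map_eq_conv One_nat_def)
  then show "eval T I \<sigma> (app p v [0]) \<longleftrightarrow> map s v \<in> I (p, length v)"
    and "eval T I \<sigma> (app p v [0, 1]) \<longleftrightarrow> map s v @ map s' v \<in> I (p, 2 * length v)"
    unfolding eval_app by (simp_all only: list.size mult_1 add_0 One_nat_def add_Suc_right add_0_right numeral_2_eq_2 mult_Suc mult_0)
  show "eval T I \<sigma> (conjs (map (\<lambda>x. Eq (Var (x, 1)) (Var (x, 0))) v)) \<longleftrightarrow> map s' v = map s v"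
    by (auto simp: eval_conjs \<sigma>_def)
qed

lemma set_next_U_parts:
  "set [f l lt lf. Cond l lt lf \<leftarrow> H] = {f l lt lf | l lt lf. Cond l lt lf \<in> set H}"
  "set [g l l'. Assign l l' \<leftarrow> H] = {g l l' | l l'. Assign l l' \<in> set H}"
  by (induction H) (auto split: hole.splits)

lemma bex_Collect_image:
  "(\<exists>f\<in>{F a b c | a b c. Q a b c}. E f) \<longleftrightarrow> (\<exists>a b c. Q a b c \<and> E (F a b c))"
  "(\<exists>f\<in>{G a b | a b. R a b}. E f) \<longleftrightarrow> (\<exists>a b. R a b \<and> E (G a b))"
  by blast+

lemma preds_conjs: "preds (conjs fs) = (\<Union>f\<in>set fs. preds f)"
  by (induction fs) (auto simp: conjs_def)

lemma preds_disjs: "preds (disjs fs) = (\<Union>f\<in>set fs. preds f)"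
  by (induction fs) (auto simp: disjs_def)

lemma fvars_conjs: "fvars (conjs fs) = (\<Union>f\<in>set fs. fvars f)"
  by (induction fs) (auto simp: conjs_def)

lemma fvars_disjs: "fvars (disjs fs) = (\<Union>f\<in>set fs. fvars f)"
  by (induction fs) (auto simp: disjs_def)

lemma fvars_next_U:
  assumes "fvars (nxt P) \<subseteq> set (vars P) \<times> {0, 1}" "pc \<in> set (vars P)"
  shows "fvars (next_U pc P H u) \<subseteq> set (vars P) \<times> {0, 1}"
  using assms unfolding next_U_def Let_def fvars_disjs set_append set_next_U_parts
  by (auto simp: fvars_conjs fvars_app rvars_def)

text \<open>Puts the hole predicates among the symbols in use at the start, so that no later choice
  reinterprets them and \<open>Delta_a\<close> stays true.\<close>

lemma hole_pred_in_next_U: "h \<in> set H \<Longrightarrow> hole_pred u (rvars pc P) h \<in> preds (next_U pc P H u)"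
  unfolding next_U_def Let_def preds_disjs set_append set_next_U_parts
  by (cases h) (fastforce simp: preds_conjs preds_app)+

section \<open>The resolving function as an interpretation\<close>

context
  fixes T :: "('f, 'r, 'x, 'e) background" and pc :: 'x and P :: "('f, 'r, 'p, 'x, 'e) program"
    and H :: "'e hole list" and u :: "'e hole \<Rightarrow> 'p"
    and \<Psi>c :: "'e hole \<Rightarrow> 'e list set" and \<Psi>a :: "'e hole \<Rightarrow> ('e list \<times> 'e list) set"
    and I :: "'p pred \<Rightarrow> 'e list set"
  assumes prog: "partial_program T pc P H" and res: "resolving T (rvars pc P) H \<Psi>c \<Psi>a"
    and inj: "inj_on (hole_pred u (rvars pc P)) (set H)"
  defines "I \<equiv> hole_interp (hole_pred u (rvars pc P)) (set H) (hole_rel \<Psi>c \<Psi>a)"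
begin

lemma interp_Cond:
  "Cond l lt lf \<in> set H \<Longrightarrow> I (u (Cond l lt lf), length (rvars pc P)) = \<Psi>c (Cond l lt lf)"
  using hole_interp[OF inj, of "Cond l lt lf"] by (simp add: I_def hole_rel_def)

text \<open>A concatenation determines the pair only once the split point is known; by
  \<open>resolving\<close> all first components have the length of
  \<open>rvars pc P\<close>.\<close>

lemma interp_Assign:
  assumes "Assign l l' \<in> set H" "length as = length (rvars pc P)"
  shows "as @ bs \<in> I (u (Assign l l'), 2 * length (rvars pc P)) \<longleftrightarrow> (as, bs) \<in> \<Psi>a (Assign l l')"
proof -
  have "length cs = length as" if "(cs, ds) \<in> \<Psi>a (Assign l l')" for cs ds
    using res assms that unfolding resolving_def by (fastforce dest: tuples_length)
  then have "as @ bs \<in> hole_rel \<Psi>c \<Psi>a (Assign l l') \<longleftrightarrow> (as, bs) \<in> \<Psi>a (Assign l l')"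
    unfolding hole_rel_def by (force simp: append_eq_append_conv)
  then show ?thesis using hole_interp[OF inj assms(1)] by (simp add: I_def)
qed

lemma interpretation_I: "interpretation_of_preds I"
  unfolding interpretation_of_preds_def
proof (intro allI subsetI CollectI)
  fix p n as assume "as \<in> I (p, n)"
  then obtain h where h: "h \<in> set H" "hole_pred u (rvars pc P) h = (p, n)" "as \<in> hole_rel \<Psi>c \<Psi>a h"
    by (auto simp: I_def hole_interp_def)
  show "length as = n"
  proof (cases h)
    case (Cond l lt lf)
    then have "as \<in> tuples T (rvars pc P)" using h res by (auto simp: resolving_def hole_rel_def)
    then show ?thesis using h(2) Cond tuples_length by auto
  next
    case (Assign l l')
    then obtain bs cs where "as = bs @ cs" "bs \<in> tuples T (rvars pc P)" "cs \<in> tuples T (rvars pc P)"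
      using h res by (force simp: resolving_def hole_rel_def)
    then show ?thesis using h(2) Assign by (auto dest!: tuples_length)
  qed
qed

lemma hold_assertion: "assertion_over V c \<Longrightarrow> hold T I c s = holds T c s"
  unfolding hold_def holds_def by (intro eval_cong) (auto simp: assertion_over_def)

lemma hold2_assertion: "assertion_over V c \<Longrightarrow> hold2 T I c s s' = holds2 T c s s'"
  unfolding hold2_def holds2_def by (intro eval_cong) (auto simp: assertion_over_def)

text \<open>Disjunct by disjunct, \<open>next_U\<close> evaluates to the step relation of the
  synthesized program, and both restrict steps to legal states. Hence the systems are equal and no
  simulation argument is needed.\<close>

lemma sem_P_U: "sem T I (P_U pc P H u) = synthesized T pc P H \<Psi>c \<Psi>a"
proof -
  let ?vr = "rvars pc P"
  have p: "program P" using prog by (simp add: partial_program_def)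
  have "hold2 T I (next_U pc P H u) s s' \<longleftrightarrow>
      (holds2 T (nxt P) s s' \<or>
        (\<exists>l lt lf. Cond l lt lf \<in> set H \<and> s pc = l \<and> s' pc = lt \<and>
           map s ?vr \<in> \<Psi>c (Cond l lt lf) \<and> map s' ?vr = map s ?vr) \<or>
        (\<exists>l lt lf. Cond l lt lf \<in> set H \<and> s pc = l \<and> s' pc = lf \<and>
           map s ?vr \<notin> \<Psi>c (Cond l lt lf) \<and> map s' ?vr = map s ?vr) \<or>
        (\<exists>l l'. Assign l l' \<in> set H \<and> s pc = l \<and> s' pc = l' \<and>
           (map s ?vr, map s' ?vr) \<in> \<Psi>a (Assign l l')))" for s s'
  proof -
    let ?\<sigma> = "\<lambda>(x, n :: nat). if n = 0 then s x else s' x"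
    let ?frame = "conjs (map (\<lambda>x. Eq (Var (x, 1)) (Var (x, 0))) ?vr) :: ('f, 'r, 'p, 'x, 'e) fm"
    let ?jump = "\<lambda>l l'. Conj (Eq (Var (pc, 0)) (Val l)) (Eq (Var (pc, 1)) (Val l')) :: ('f, 'r, 'p, 'x, 'e) fm"
    have nxt: "eval T I ?\<sigma> (nxt P) \<longleftrightarrow> holds2 T (nxt P) s s'"
      using hold2_assertion p unfolding program_def hold2_def by blast
    have 1: "eval T I ?\<sigma> (conjs [?jump l lt, app (u (Cond l lt lf)) ?vr [0], ?frame]) \<longleftrightarrow>
        s pc = l \<and> s' pc = lt \<and> map s ?vr \<in> \<Psi>c (Cond l lt lf) \<and> map s' ?vr = map s ?vr"
      and 2: "eval T I ?\<sigma> (conjs [?jump l lf, Neg (app (u (Cond l lt lf)) ?vr [0]), ?frame]) \<longleftrightarrow>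
        s pc = l \<and> s' pc = lf \<and> map s ?vr \<notin> \<Psi>c (Cond l lt lf) \<and> map s' ?vr = map s ?vr"
      if "Cond l lt lf \<in> set H" for l lt lf
      unfolding eval_conjs[of _ _ _ "_ # _"]
      using hold2_hole(1,3)[where T = T and I = I and s = s and s' = s' and v = ?vr] interp_Cond[OF that]
      by (simp_all del: One_nat_def map_eq_conv)
    have 3: "eval T I ?\<sigma> (conjs [?jump l l', app (u (Assign l l')) ?vr [0, 1]]) \<longleftrightarrow>
        s pc = l \<and> s' pc = l' \<and> (map s ?vr, map s' ?vr) \<in> \<Psi>a (Assign l l')"
      if "Assign l l' \<in> set H" for l l'
      unfolding eval_conjs[of _ _ _ "_ # _"]
      using hold2_hole(2)[where T = T and I = I and s = s and s' = s' and v = ?vr] interp_Assign[OF that, of "map s ?vr"]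
      by (simp del: One_nat_def map_eq_conv)
    show ?thesis
      unfolding hold2_def next_U_def Let_def eval_disjs set_append set_next_U_parts bex_Un bex_Collect_image
      \<comment> \<open>The equivalences 1, 2 and 3 are conditional on the hole being in
        \<open>H\<close>; \<open>conj_cong\<close> supplies this from the left conjunct.\<close>
      by (simp only: nxt 1 2 3 list.set bex_simps cong: conj_cong) simp
  qed
  moreover have "map (hold T I) (fair P) = map (holds T) (fair P)"
    using p hold_assertion by (auto simp: program_def fun_eq_iff)
  moreover have "hold T I (init P) s = holds T (init P) s" for s
    using p hold_assertion by (auto simp: program_def)
  ultimately show ?thesis
    unfolding synthesized_def Let_def sem_def P_U_def by (simp add: fun_eq_iff del: map_eq_conv)
qed

lemma sat_Delta_a:
  assumes "agree (preds (next_U pc P H u)) L I" "c \<in> Delta_a pc P H u"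
  shows "sat_clause T L c"
proof -
  let ?vr = "rvars pc P"
  obtain l l' where c: "c = Imp Top (exs ?vr 1 (app (u (Assign l l')) ?vr [0, 1]))"
    and h: "Assign l l' \<in> set H" using assms(2) by (auto simp: Delta_a_def)
  let ?p = "(u (Assign l l'), 2 * length ?vr)"
  have L: "L ?p = I ?p" using assms(1) hole_pred_in_next_U[OF h, of u pc P] by (simp add: agree_def)
  show ?thesis unfolding c sat_Imp
  proof (intro allI impI)
    fix \<sigma> assume \<sigma>: "in_range T \<sigma>"
    let ?as = "map (slice ?vr \<sigma> 0) ?vr"
    have "?as \<in> tuples T ?vr" by (intro map_states_tuples states_slice \<sigma>)
    then obtain bs where bs: "bs \<in> tuples T ?vr" "(?as, bs) \<in> \<Psi>a (Assign l l')"
      using res h unfolding resolving_def by blast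
    \<comment> \<open>Totality of the assignment hole yields only a tuple, whereas the existential
      block over primed variables calls for a state.\<close>
    have "distinct ?vr" using prog by (simp add: rvars_def partial_program_def program_def distinct_removeAll)
    with bs(1) obtain s where s: "s \<in> states T ?vr" "map s ?vr = bs" using tuples_map_states by blast
    show "eval T L \<sigma> (exs ?vr 1 (app (u (Assign l l')) ?vr [0, 1]))"
    proof (rule slice_next[OF \<sigma> s(1)])
      fix \<tau> assume "slice ?vr \<tau> 0 = slice ?vr \<sigma> 0" "slice ?vr \<tau> 1 = s"
      then have "concat (map (\<lambda>n. map (slice ?vr \<tau> n) ?vr) [0, 1]) = ?as @ bs" using s(2) by simp
      moreover have "?as @ bs \<in> L ?p" unfolding L using interp_Assign[OF h, of ?as] bs(2) by simp
      moreover have "length [0, 1 :: nat] * length ?vr = 2 * length ?vr" by simp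
      ultimately show "eval T L \<tau> (app (u (Assign l l')) ?vr [0, 1])" unfolding eval_app by (simp only:)
    qed
  qed
qed

lemma satisfiable_synthesis:
  assumes bg: "background_theory T" and phi: "ctl_star_formula (vars P) \<phi>"
    and models: "models (holds T) (synthesized T pc P H \<Psi>c \<Psi>a) \<phi>"
    and C: "Clauses T (P_U pc P H u) \<phi> C"
  shows "satisfiable T (Delta_a pc P H u \<union> C)"
proof -
  let ?D = "P_U pc P H u" let ?N = "all_preds ?D \<phi>"
  obtain N' where tr: "translate T ?N ?D \<phi> C N'" using C by (auto simp: Clauses_def)
  have p: "program P" "pc \<in> set (vars P)" using prog by (auto simp: partial_program_def)
  have "wf_prog ?N ?D"
    unfolding wf_prog_def P_U_def over_def program.sel all_preds_def
    using p fvars_next_U[of P pc H u] by (auto simp: program_def assertion_over_def)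
  moreover have "over ?N (set (vars ?D) \<times> {0}) c" if "c \<in> set_sfm \<phi>" for c
    using phi that by (auto simp: ctl_star_formula_def assertion_over_def over_def P_U_def)
  moreover have "models (hold T I) (sem T I ?D) \<phi>"
  proof -
    have "ssat (hold T I) (sem T I ?D) \<phi> s = ssat (holds T) (synthesized T pc P H \<Psi>c \<Psi>a) \<phi> s" for s
      unfolding sem_P_U using phi hold_assertion
      by (intro sat_cong(1)) (auto simp: ctl_star_formula_def)
    then show ?thesis using models by (simp add: models_def sem_P_U)
  qed
  ultimately have "extends_to T ?N N' I C"
    using bg interpretation_I by (intro translate_sound[OF tr]) (auto simp: background_theory_def)
  then obtain K where K: "interpretation_of_preds K" "agree ?N K I" "\<forall>c\<in>C. sat_clause T K c"
    unfolding extends_to_def agree_def by blast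
  have "agree (preds (next_U pc P H u)) K I"
    using K(2) by (auto simp: agree_def all_preds_def P_U_def)
  then show ?thesis unfolding satisfiable_def using K(1,3) sat_Delta_a by blast
qed

end

theorem theorem5:
  fixes T :: "('f, 'r, 'x, 'e) background"
    and pc :: 'x
    and P :: "('f, 'r, 'p, 'x, 'e) program"
    and H :: "'e hole list"
    and \<phi> :: "('f, 'r, 'p, 'x, 'e) fm sfm"
    and C :: "('f, 'r, 'p, 'x, 'e) clause set"
  assumes "background_theory T"
    and "partial_program T pc P H"
    and "ctl_star_formula (vars P) \<phi>"
    and "realizable T pc P H \<phi>"
    and "Delta T pc P H \<phi> C"
  shows "satisfiable T C"
proof -
  obtain \<Psi>c \<Psi>a where \<Psi>: "resolving T (rvars pc P) H \<Psi>c \<Psi>a"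
    "models (holds T) (synthesized T pc P H \<Psi>c \<Psi>a) \<phi>"
    using assms(4) by (auto simp: realizable_def)
  obtain u C' where u: "inj_on (hole_pred u (rvars pc P)) (set H)" "Clauses T (P_U pc P H u) \<phi> C'"
    and C: "C = Delta_a pc P H u \<union> C'"
    using assms(5) by (auto simp: Delta_def)
  show ?thesis
    unfolding C by (rule satisfiable_synthesis[OF assms(2) \<Psi>(1) u(1) assms(1,3) \<Psi>(2) u(2)])
qed

end
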